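(* Let $V$ be an $\mathbb{R}$-vector space of dimension $N\ge 2$ with a fixed basis $e_1,\dots,e_N$, and let $k\in\{1,\dots,N-1\}$. Let $Gr^k$ be the Grassmannian of $k$-dimensional subspaces of $V$, let $Gr^k_{>0}\subset Gr^k$ be its totally positive part (the set of all $F_k$, where $F_1\subset F_2\subset\dots\subset F_{N-1}$ runs over the totally positive complete flags in $V$), and let $Gr'^k_{>0}\subset Gr^k$ be the set of all $E\in Gr^k$ such that the line $\Lambda^kE\subset\Lambda^kV$ is spanned by a vector all of whose coordinates with respect to the basis $\{e_I\,;\,I\subset\{1,\dots,N\},\ |I|=k\}$ of $\Lambda^kV$ are in $\mathbb{R}_{>0}$. Then $$Gr'^k_{>0}=Gr^k_{>0}.$$
   Context: For $I=\{i_1<i_2<\dots<i_k\}\subset\{1,\dots,N\}$, set $e_I=e_{i_1}\wedge e_{i_2}\wedge\dots\wedge e_{i_k}\in\Lambda^kV$. $\mathcal{B}$ denotes the manifold of complete flags $F_1\subset F_2\subset\dots\subset F_{N-1}$ in $V$, with $\dim F_i=i$. Totally positive flags: identify $GL(V)$ with invertible $N\times N$ real matrices by means of the basis $e_1,\dots,e_N$ (so that the $j$-th column of $g$ gives the coordinates of $g(e_j)$). Let $U^-_{>0}$ be the set of lower triangular unipotent matrices $u$ such that every minor of $u$ which does not vanish identically on the set of all lower triangular unipotent matrices is $>0$; explicitly, for every $m\in\{1,\dots,N\}$ and every choice of rows $i_1<\dots<i_m$ and columns $j_1<\dots<j_m$ with $i_a\ge j_a$ for all $a$, the corresponding minor of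 $u$ is $>0$. The totally positive part $\mathcal{B}_{>0}$ of $\mathcal{B}$ is the set of flags $F_1\subset\dots\subset F_{N-1}$ of the form $F_i=u(\mathrm{span}(e_1,\dots,e_i))$ for $i=1,\dots,N-1$, with $u\in U^-_{>0}$. $Gr^k_{>0}$ is the image of $\mathcal{B}_{>0}$ under the map $\mathcal{B}\to Gr^k$, $(F_1\subset\dots\subset F_{N-1})\mapsto F_k$. *)

theory Defs
  imports
    "HOL-Analysis.Finite_Function_Topology"
    "Jordan_Normal_Form.Determinant"
    "Jordan_Normal_Form.DL_Submatrix"
begin

text \<open>
  Indices are shifted to start at 0, as usual for matrices here: the basis of \<open>V\<close> is
  \<open>e 0, \<dots>, e (N - 1)\<close>, so that \<open>span (e ` {..<i})\<close> is the span of the first \<open>i\<close> basis vectors.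
\<close>

definition ordered_basis :: "nat \<Rightarrow> (nat \<Rightarrow> 'v::real_vector) \<Rightarrow> bool" where
  "ordered_basis N e \<longleftrightarrow>
     inj_on e {..<N} \<and> independent (e ` {..<N}) \<and> span (e ` {..<N}) = UNIV"


section \<open>The exterior algebra\<close>

text \<open>
  The exterior algebra \<open>T(V) / (v \<otimes> v)\<close>. It is the quotient of the free real vector space on
  all finite lists of vectors (a list standing for the tensor product of its entries) by the
  subspace spanned by the relations of multilinearity and by the tensors
  \<open>x\<^sub>1 \<otimes> \<dots> \<otimes> v \<otimes> v \<otimes> \<dots> \<otimes> y\<^sub>l\<close>.
\<close>

abbreviation free_vec :: "'v list \<Rightarrow> 'v list \<Rightarrow>\<^sub>0 real" where
  "free_vec vs \<equiv> Poly_Mapping.single vs 1"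

definition exterior_relations :: "('v::real_vector list \<Rightarrow>\<^sub>0 real) set" where
  "exterior_relations =
     {free_vec (xs @ (u + v) # ys) - free_vec (xs @ u # ys) - free_vec (xs @ v # ys) |xs u v ys. True}
   \<union> {free_vec (xs @ (c *\<^sub>R v) # ys) - c *\<^sub>R free_vec (xs @ v # ys) |xs c v ys. True}
   \<union> {free_vec (xs @ v # v # ys) |xs v ys. True}"

definition exterior_eq ::
    "('v::real_vector list \<Rightarrow>\<^sub>0 real) \<Rightarrow> ('v list \<Rightarrow>\<^sub>0 real) \<Rightarrow> bool" where
  "exterior_eq x y \<longleftrightarrow> x - y \<in> span exterior_relations"

quotient_type (overloaded) 'v exterior = "'v::real_vector list \<Rightarrow>\<^sub>0 real" / exterior_eq
proof (rule equivpI)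
  show "reflp (exterior_eq :: ('v list \<Rightarrow>\<^sub>0 real) \<Rightarrow> _)"
    by (simp add: reflp_def exterior_eq_def span_zero)
  show "symp (exterior_eq :: ('v list \<Rightarrow>\<^sub>0 real) \<Rightarrow> _)"
    unfolding symp_def exterior_eq_def by (metis minus_diff_eq span_neg)
  show "transp (exterior_eq :: ('v list \<Rightarrow>\<^sub>0 real) \<Rightarrow> _)"
  proof (rule transpI)
    fix x y z :: "'v list \<Rightarrow>\<^sub>0 real"
    assume "exterior_eq x y" "exterior_eq y z"
    then have "(x - y) + (y - z) \<in> span exterior_relations"
      unfolding exterior_eq_def by (rule span_add)
    then show "exterior_eq x z"
      by (simp add: exterior_eq_def)
  qed
qed

instantiation exterior :: (real_vector) real_vector
begin

lift_definition zero_exterior :: "'a exterior" is 0 .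

lift_definition plus_exterior :: "'a exterior \<Rightarrow> 'a exterior \<Rightarrow> 'a exterior" is "(+)"
  unfolding exterior_eq_def by (simp only: add_diff_add span_add)

lift_definition uminus_exterior :: "'a exterior \<Rightarrow> 'a exterior" is uminus
  unfolding exterior_eq_def by (simp only: minus_diff_minus span_neg)

lift_definition minus_exterior :: "'a exterior \<Rightarrow> 'a exterior \<Rightarrow> 'a exterior" is "(-)"
proof -
  fix x x' y y' :: "'a list \<Rightarrow>\<^sub>0 real"
  assume "exterior_eq x x'" "exterior_eq y y'"
  moreover have "x - y - (x' - y') = (x - x') - (y - y')"
    by (simp add: algebra_simps)
  ultimately show "exterior_eq (x - y) (x' - y')"
    unfolding exterior_eq_def by (simp only: span_diff)
qed

lift_definition scaleR_exterior :: "real \<Rightarrow> 'a exterior \<Rightarrow> 'a exterior" is "(*\<^sub>R)"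
  unfolding exterior_eq_def by (simp only: scaleR_right_diff_distrib[symmetric] span_scale)

instance
  by standard
    (transfer; simp add: exterior_eq_def span_zero algebra_simps)+

end

text \<open>The product \<open>v\<^sub>1 \<and> \<dots> \<and> v\<^sub>k\<close> of the entries of a list.\<close>

lift_definition wedge :: "'v::real_vector list \<Rightarrow> 'v exterior" is free_vec .

text \<open>The subspace \<open>\<Lambda>\<^sup>k E\<close> of \<open>\<Lambda>\<^sup>k V\<close>, for a subspace \<open>E\<close> of \<open>V\<close>.\<close>

definition exterior_power :: "nat \<Rightarrow> 'v::real_vector set \<Rightarrow> 'v exterior set" where
  "exterior_power k E = span (wedge ` {vs. length vs = k \<and> set vs \<subseteq> E})"

definition wedge_basis :: "(nat \<Rightarrow> 'v::real_vector) \<Rightarrow> nat set \<Rightarrow> 'v exterior" where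
  "wedge_basis e I = wedge (map e (sorted_list_of_set I))"

lemma wedge_add: "wedge (xs @ (u + v) # ys) = wedge (xs @ u # ys) + wedge (xs @ v # ys)"
proof transfer
  fix xs ys :: "'a list" and u v
  have "free_vec (xs @ (u + v) # ys) - free_vec (xs @ u # ys) - free_vec (xs @ v # ys)
      \<in> exterior_relations"
    unfolding exterior_relations_def by blast
  then show "exterior_eq (free_vec (xs @ (u + v) # ys))
      (free_vec (xs @ u # ys) + free_vec (xs @ v # ys))"
    by (simp add: exterior_eq_def diff_diff_eq span_base)
qed

lemma wedge_scaleR: "wedge (xs @ (c *\<^sub>R v) # ys) = c *\<^sub>R wedge (xs @ v # ys)"
proof transfer
  fix xs ys :: "'a list" and c v
  have "free_vec (xs @ (c *\<^sub>R v) # ys) - c *\<^sub>R free_vec (xs @ v # ys) \<in> exterior_relations"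
    unfolding exterior_relations_def by blast
  then show "exterior_eq (free_vec (xs @ (c *\<^sub>R v) # ys)) (c *\<^sub>R free_vec (xs @ v # ys))"
    by (simp add: exterior_eq_def span_base)
qed

lemma wedge_alternating: "wedge (xs @ v # v # ys) = 0"
proof transfer
  fix xs ys :: "'a list" and v
  have "free_vec (xs @ v # v # ys) \<in> exterior_relations"
    unfolding exterior_relations_def by blast
  then show "exterior_eq (free_vec (xs @ v # v # ys)) 0"
    by (simp add: exterior_eq_def span_base)
qed


section \<open>Grassmannians and flags\<close>

definition grassmannian :: "nat \<Rightarrow> 'v::real_vector set set" where
  "grassmannian k = {E. subspace E \<and> dim E = k}"

text \<open>
  A flag is a family of subspaces indexed by \<open>{1..N-1}\<close>. Requiring it to be extensional makes
  distinct families distinct flags.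
\<close>

definition complete_flags :: "nat \<Rightarrow> (nat \<Rightarrow> 'v::real_vector set) set" where
  "complete_flags N =
     {F \<in> \<Pi>\<^sub>E i\<in>{1..N - 1}. grassmannian i. \<forall>i\<in>{1..<N - 1}. F i \<subseteq> F (Suc i)}"

definition lower_unipotent :: "nat \<Rightarrow> real mat set" where
  "lower_unipotent N =
     {u \<in> carrier_mat N N. (\<forall>i<N. u $$ (i, i) = 1) \<and> (\<forall>i<N. \<forall>j<N. i < j \<longrightarrow> u $$ (i, j) = 0)}"

definition minor :: "real mat \<Rightarrow> nat set \<Rightarrow> nat set \<Rightarrow> real" where
  "minor u I J = Determinant.det (submatrix u I J)"

definition totally_positive_unipotent :: "nat \<Rightarrow> real mat set" where
  "totally_positive_unipotent N =
     {u \<in> lower_unipotent N.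
        \<forall>I J. I \<subseteq> {..<N} \<longrightarrow> J \<subseteq> {..<N} \<longrightarrow> card I = card J \<longrightarrow> I \<noteq> {} \<longrightarrow>
          (\<exists>w\<in>lower_unipotent N. minor w I J \<noteq> 0) \<longrightarrow> minor u I J > 0}"

text \<open>The endomorphism of \<open>V\<close> with matrix \<open>u\<close> in the basis \<open>e\<close>.\<close>

definition mat_action :: "nat \<Rightarrow> (nat \<Rightarrow> 'v::real_vector) \<Rightarrow> real mat \<Rightarrow> 'v \<Rightarrow> 'v" where
  "mat_action N e u v =
     (\<Sum>j<N. representation (e ` {..<N}) v (e j) *\<^sub>R (\<Sum>i<N. u $$ (i, j) *\<^sub>R e i))"

definition totally_positive_flags ::
    "nat \<Rightarrow> (nat \<Rightarrow> 'v::real_vector) \<Rightarrow> (nat \<Rightarrow> 'v set) set" where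
  "totally_positive_flags N e =
     {F \<in> complete_flags N. \<exists>u\<in>totally_positive_unipotent N.
        \<forall>i\<in>{1..N - 1}. F i = mat_action N e u ` span (e ` {..<i})}"

definition totally_positive_grassmannian ::
    "nat \<Rightarrow> (nat \<Rightarrow> 'v::real_vector) \<Rightarrow> nat \<Rightarrow> 'v set set" where
  "totally_positive_grassmannian N e k = (\<lambda>F. F k) ` totally_positive_flags N e"

definition pluecker_positive_grassmannian ::
    "nat \<Rightarrow> (nat \<Rightarrow> 'v::real_vector) \<Rightarrow> nat \<Rightarrow> 'v set set" where
  "pluecker_positive_grassmannian N e k =
     {E \<in> grassmannian k. \<exists>\<omega>. exterior_power k E = span {\<omega>} \<and>
        (\<forall>I. I \<subseteq> {..<N} \<longrightarrow> card I = k \<longrightarrow>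
           representation (wedge_basis e ` {I. I \<subseteq> {..<N} \<and> card I = k}) \<omega> (wedge_basis e I) > 0)}"


section \<open>Basic facts\<close>

lemma mat_action_basis:
  assumes "ordered_basis N e" "j < N"
  shows "mat_action N e u (e j) = (\<Sum>i<N. u $$ (i, j) *\<^sub>R e i)"
proof -
  have "representation (e ` {..<N}) (e j) (e l) = (if l = j then 1 else 0)" if "l < N" for l
    using assms that unfolding ordered_basis_def
    by (auto simp: representation_basis inj_on_eq_iff)
  then have "mat_action N e u (e j)
      = (\<Sum>l<N. (if l = j then 1 else 0) *\<^sub>R (\<Sum>i<N. u $$ (i, l) *\<^sub>R e i))"
    unfolding mat_action_def by (intro sum.cong) auto
  also have "\<dots> = (\<Sum>l<N. if l = j then \<Sum>i<N. u $$ (i, l) *\<^sub>R e i else 0)"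
    by (intro sum.cong) auto
  also have "\<dots> = (\<Sum>i<N. u $$ (i, j) *\<^sub>R e i)"
    using assms(2) by simp
  finally show ?thesis .
qed

lemma linear_mat_action:
  assumes "ordered_basis N e"
  shows "linear (mat_action N e u)"
proof (rule linearI)
  fix x y c
  show "mat_action N e u (x + y) = mat_action N e u x + mat_action N e u y"
    using assms unfolding mat_action_def ordered_basis_def
    by (simp add: representation_add scaleR_left_distrib sum.distrib)
  show "mat_action N e u (c *\<^sub>R x) = c *\<^sub>R mat_action N e u x"
    using assms unfolding mat_action_def ordered_basis_def
    by (simp add: representation_scale scaleR_sum_right mult.assoc)
qed

text \<open>
  A minor vanishes identically on the lower triangular unipotent matrices unless its rows
  \<open>i\<^sub>1 < \<dots> < i\<^sub>m\<close> and columns \<open>j\<^sub>1 < \<dots> < j\<^sub>m\<close> satisfy \<open>i\<^sub>a \<ge> j\<^sub>a\<close> for all \<open>a\<close>.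
\<close>

lemma pick_less_imp_less:
  assumes "pick S a < pick S b" "a < card S" "b < card S"
  shows "a < b"
  using assms pick_mono_le[of a S b] by (metis linorder_neqE_nat order_less_asym)

lemma pick_lt_bound:
  assumes "I \<subseteq> {..<N}" "a < card I"
  shows "pick I a < N"
  using pick_in_set_le[OF assms(2)] assms(1) by auto

lemma minor_eq:
  assumes "w \<in> carrier_mat N N" "I \<subseteq> {..<N}" "J \<subseteq> {..<N}" "card I = card J"
  shows "minor w I J
    = Determinant.det (mat (card I) (card I) (\<lambda>(a, b). w $$ (pick I a, pick J b)))"
proof -
  have "{i. i < N \<and> i \<in> I} = I" "{i. i < N \<and> i \<in> J} = J"
    using assms by auto
  then show ?thesis
    using assms by (simp add: minor_def submatrix_def)
qed

lemma nonvanishing_minor_iff: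
  assumes I: "I \<subseteq> {..<N}" and J: "J \<subseteq> {..<N}" and IJ: "card I = card J"
  shows "(\<exists>w\<in>lower_unipotent N. minor w I J \<noteq> 0) \<longleftrightarrow> (\<forall>a<card I. pick J a \<le> pick I a)"
proof
  assume "\<exists>w\<in>lower_unipotent N. minor w I J \<noteq> 0"
  then obtain w where w: "w \<in> lower_unipotent N" "minor w I J \<noteq> 0"
    by blast
  define m where "m = card I"
  define A where "A = mat m m (\<lambda>(a, b). w $$ (pick I a, pick J b))"
  have A: "A \<in> carrier_mat m m"
    by (simp add: A_def)
  have wN: "w \<in> carrier_mat N N" and tri: "\<And>i j. i < j \<Longrightarrow> j < N \<Longrightarrow> w $$ (i, j) = 0"
    using w(1) by (auto simp: lower_unipotent_def)
  have "Determinant.det A \<noteq> 0"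
    using w(2) minor_eq[OF wN I J IJ] by (simp add: A_def m_def)
  then have "\<exists>p. p permutes {0..<m} \<and> (\<Prod>i = 0..<m. A $$ (i, p i)) \<noteq> 0"
    unfolding det_def'[OF A] by (metis (mono_tags, lifting) mem_Collect_eq mult_zero_right sum.neutral)
  then obtain p where p: "p permutes {0..<m}" "(\<Prod>i = 0..<m. A $$ (i, p i)) \<noteq> 0"
    by blast
  have ge: "pick J (p a) \<le> pick I a" if "a < m" for a
  proof (rule ccontr)
    assume "\<not> ?thesis"
    moreover have "p a < m"
      using that permutes_in_image[OF p(1), of a] by simp
    moreover from this have "pick J (p a) < N"
      using pick_lt_bound[OF J] IJ m_def by simp
    ultimately have "A $$ (a, p a) = 0"
      using that tri by (simp add: A_def)
    then show False
      using p(2) that by (auto simp: prod_zero_iff)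
  qed
  show "\<forall>a<card I. pick J a \<le> pick I a"
  proof (intro allI impI, rule ccontr)
    fix a assume a: "a < card I" and neg: "\<not> pick J a \<le> pick I a"
    have "p b < a" if "b \<le> a" for b
    proof -
      have bm: "b < m" and pbm: "p b < m"
        using that a permutes_in_image[OF p(1), of b] by (auto simp: m_def)
      have "pick J (p b) \<le> pick I b"
        by (rule ge[OF bm])
      also have "pick I b \<le> pick I a"
        using that a pick_mono_le[of a I b] by (cases "b = a") auto
      also have "\<dots> < pick J a"
        using neg by simp
      finally show ?thesis
        using pick_less_imp_less[of J "p b" a] a pbm IJ m_def by simp
    qed
    then have "p ` {..a} \<subseteq> {..<a}"
      by auto
    then have "card (p ` {..a}) \<le> a"
      using card_mono[of "{..<a}"] by fastforce
    moreover have "card (p ` {..a}) = Suc a"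
      using card_image[of p "{..a}"] permutes_inj_on[OF p(1)] by simp
    ultimately show False
      by simp
  qed
next
  assume le: "\<forall>a<card I. pick J a \<le> pick I a"
  define w :: "real mat" where
    "w = mat N N (\<lambda>(i, j). if i = j \<or> (\<exists>a<card I. i = pick I a \<and> j = pick J a) then 1 else 0)"
  have w: "w \<in> lower_unipotent N"
    using le by (auto simp: lower_unipotent_def w_def)
  define A where "A = mat (card I) (card I) (\<lambda>(a, b). w $$ (pick I a, pick J b))"
  have A: "A \<in> carrier_mat (card I) (card I)"
    by (simp add: A_def)
  have bnd: "pick I a < N" "pick J a < N" if "a < card I" for a
    using that pick_lt_bound[OF I] pick_lt_bound[OF J] IJ by simp_all
  have diag: "A $$ (a, a) = 1" if "a < card I" for a
    using that bnd by (auto simp: A_def w_def)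
  have "A $$ (a, b) = 0" if ba: "b < a" "a < card I" for a b
  proof -
    have J': "pick J b < pick J a" and I': "pick J a \<le> pick I a"
      using ba IJ le pick_mono_le[of a J b] by auto
    have "\<not> (pick I a = pick I c \<and> pick J b = pick J c)" if c: "c < card I" for c
    proof
      assume eq: "pick I a = pick I c \<and> pick J b = pick J c"
      have "a = c"
        using eq c ba(2) pick_mono_le by (metis linorder_neqE_nat less_irrefl)
      then show False
        using eq J' by simp
    qed
    then show ?thesis
      using ba bnd J' I' by (auto simp: A_def w_def)
  qed
  then have "upper_triangular A"
    by (auto simp: upper_triangular_def A_def)
  then have "Determinant.det A = prod_list (diag_mat A)"
    by (rule det_upper_triangular[OF _ A])
  also have "\<dots> = 1"
    using diag A by (simp add: prod_list_diag_prod)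
  finally have "minor w I J \<noteq> 0"
    using w I J IJ by (simp add: minor_eq[of w N] lower_unipotent_def A_def)
  then show "\<exists>w\<in>lower_unipotent N. minor w I J \<noteq> 0"
    using w by blast
qed

end

theory Submission
  imports Defs
begin

text \<open>
  If \<open>u\<close> is totally positive, the Pluecker coordinates of \<open>u (span (e\<^sub>0, \<dots>, e\<^sub>k\<^sub>-\<^sub>1))\<close> are the
  minors of \<open>u\<close> in the first \<open>k\<close> columns. None of them vanishes identically, so they are positive
  (\<open>totally_positive_imp_pluecker_positive\<close>).

  For the converse, let all Pluecker coordinates of \<open>E\<close> be positive. The subspace \<open>E\<close> is a member of
  a complete flag all of whose members have Pluecker coordinates of one sign:
  going up, the line spanned by \<open>\<Sum> t\<^sup>N\<^sup>-\<^sup>1\<^sup>-\<^sup>i e\<^sub>i\<close> is added to the last subspace found; going down, the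
  last subspace found is intersected with the kernel of the functional \<open>\<Sum> (- t)\<^sup>i x\<^sub>i\<close>. In both
  cases every new coordinate is a polynomial in \<open>t\<close> whose lowest term is, up to a common factor, a
  Pluecker coordinate of the old subspace, so that \<open>t > 0\<close> small enough does the job
  (\<open>same_sign_minors_extend\<close>, \<open>same_sign_minors_restrict\<close>).

  As the leading minors of such a flag do not vanish, it is \<open>u\<close> applied to the standard flag for a
  lower triangular unipotent \<open>u\<close>, whose minors in initial columns are then positive
  (\<open>unipotent_basis\<close>). That all other minors of \<open>u\<close> are positive is a triangular version of Fekete's
  criterion (\<open>unipotent_minor_positive\<close>). Bordering by rows with a single nonzero entry turns minors
  in consecutive columns into minors in initial columns, and a three-term Pluecker relation closes
  the gaps of an arbitrary set of columns.

  Minors in the coordinates of \<open>V\<close> and the exterior power of the statement are linked by the fact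
  that determinants define linear functionals on the exterior algebra, which are dual to the basis
  \<open>e\<^sub>I\<close> (\<open>determinant_functional\<close>, \<open>pluecker_coordinate\<close>). They also show that the minors of two
  families spanning the same subspace are proportional (\<open>minors_proportional\<close>), so that
  having minors of one sign is a property of the subspace.
\<close>

section \<open>Determinants\<close>

text \<open>
  Giving a matrix by a function of its two indices makes the choice of rows and columns a
  composition of functions.
\<close>

definition fdet :: "nat \<Rightarrow> (nat \<Rightarrow> nat \<Rightarrow> real) \<Rightarrow> real" where
  "fdet n A = Determinant.det (mat n n (\<lambda>(i, j). A i j))"

lemma fdet_cong:
  assumes "\<And>i j. i < n \<Longrightarrow> j < n \<Longrightarrow> A i j = B i j"
  shows "fdet n A = fdet n B"
  unfolding fdet_def by (intro arg_cong[of _ _ Determinant.det] eq_matI) (auto simp: assms)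

lemma fdet_0 [simp]: "fdet 0 A = 1"
  by (simp add: fdet_def)

lemma fdet_transpose: "fdet n (\<lambda>i j. A j i) = fdet n A"
proof -
  have "mat n n (\<lambda>(i, j). A j i) = transpose_mat (mat n n (\<lambda>(i, j). A i j))"
    by (intro eq_matI) auto
  then show ?thesis
    unfolding fdet_def by (simp add: det_transpose[of _ n])
qed

text \<open>
  The cofactors along row \<open>q\<close> do not depend on that row: the determinant is a linear form in it.
\<close>

lemma fdet_row_expansion:
  assumes "q < n"
  obtains C where "\<And>y. fdet n (A(q := y)) = (\<Sum>j<n. C j * y j)"
proof
  fix y
  let ?M = "\<lambda>y. mat n n (\<lambda>(i, j). (A(q := y)) i j)"
  have "cofactor (?M y) q j = cofactor (?M (A q)) q j" if "j < n" for j
  proof -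
    have "mat_delete (?M y) q j = mat_delete (?M (A q)) q j"
      using assms that by (intro eq_matI) (auto simp: mat_delete_def)
    then show ?thesis
      by (simp add: cofactor_def)
  qed
  then have "(\<Sum>j<n. ?M y $$ (q, j) * cofactor (?M y) q j) = (\<Sum>j<n. cofactor (?M (A q)) q j * y j)"
    using assms by (intro sum.cong) auto
  then show "fdet n (A(q := y)) = (\<Sum>j<n. cofactor (?M (A q)) q j * y j)"
    unfolding fdet_def using laplace_expansion_row[OF mat_carrier, of q n] assms by metis
qed

lemma fdet_first_row:
  "fdet (Suc n) A = (\<Sum>p\<le>n. (-1) ^ p * A 0 p * fdet n (\<lambda>i j. A (Suc i) (insert_index p j)))"
proof -
  let ?M = "mat (Suc n) (Suc n) (\<lambda>(i, j). A i j)"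
  have "cofactor ?M 0 p = (-1) ^ p * fdet n (\<lambda>i j. A (Suc i) (insert_index p j))" if "p \<le> n" for p
  proof -
    have "mat_delete ?M 0 p = mat n n (\<lambda>(i, j). A (Suc i) (insert_index p j))"
      using that by (intro eq_matI) (auto simp: mat_delete_def insert_index_def)
    then show ?thesis
      by (simp add: cofactor_def fdet_def)
  qed
  then show ?thesis
    unfolding fdet_def[of "Suc n"] using laplace_expansion_row[of ?M "Suc n" 0]
    by (simp add: lessThan_Suc_atMost mult.assoc mult.left_commute)
qed

lemma fdet_first_row_single:
  assumes "p \<le> n" and "\<And>j. j \<le> n \<Longrightarrow> j \<noteq> p \<Longrightarrow> A 0 j = 0"
  shows "fdet (Suc n) A = (-1) ^ p * A 0 p * fdet n (\<lambda>i j. A (Suc i) (insert_index p j))"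
proof -
  have "fdet (Suc n) A = (\<Sum>q\<in>{p}. (-1) ^ q * A 0 q * fdet n (\<lambda>i j. A (Suc i) (insert_index q j)))"
    unfolding fdet_first_row using assms by (intro sum.mono_neutral_right) auto
  then show ?thesis
    by simp
qed

lemma fdet_equal_rows:
  assumes "p < n" "q < n" "p \<noteq> q" "\<And>j. j < n \<Longrightarrow> A p j = A q j"
  shows "fdet n A = 0"
  unfolding fdet_def by (rule det_identical_rows[of _ n p q]) (use assms in \<open>auto intro!: eq_vecI\<close>)

lemma fdet_zero_row:
  assumes "p < n" "\<And>j. j < n \<Longrightarrow> A p j = 0"
  shows "fdet n A = 0"
proof -
  obtain C where C: "\<And>y. fdet n (A(p := y)) = (\<Sum>j<n. C j * y j)"
    using fdet_row_expansion[OF assms(1)] by blast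
  show ?thesis
    using C[of "A p"] assms by simp
qed

text \<open>
  Moving row \<open>q\<close> to the top is a cycle of length \<open>q + 1\<close>.
\<close>

lemma fdet_move_row:
  assumes "q < n"
  shows "fdet n (\<lambda>i. if i = 0 then A q else if i \<le> q then A (i - 1) else A i) = (-1) ^ q * fdet n A"
    (is "fdet n ?B = _")
proof -
  have "fdet n A = (-1) ^ (q * 1) *
      Determinant.det (mat n n (\<lambda>(i, j). mat n n (\<lambda>(i, j). A i j) $$
        (if i < 1 then i + q else if i < q + 1 then i - 1 else i, j)))"
    unfolding fdet_def using assms by (intro det_swap_initial_rows) auto
  also have "mat n n (\<lambda>(i, j). mat n n (\<lambda>(i, j). A i j) $$
        (if i < 1 then i + q else if i < q + 1 then i - 1 else i, j)) = mat n n (\<lambda>(i, j). ?B i j)"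
    using assms by (intro eq_matI) auto
  finally have "fdet n A = (-1) ^ q * fdet n ?B"
    by (simp add: fdet_def)
  moreover have "(-1) ^ q * (-1 :: real) ^ q = 1"
    by (simp flip: power_mult_distrib)
  ultimately show ?thesis
    by (simp add: mult.assoc[symmetric])
qed

lemma fdet_lower_triangular:
  assumes "\<And>i j. i < j \<Longrightarrow> j < n \<Longrightarrow> A i j = 0"
  shows "fdet n A = (\<Prod>i<n. A i i)"
  unfolding fdet_def
  by (subst det_lower_triangular[of n]) (auto simp: assms prod_list_diag_prod lessThan_atLeast0)

lemma fdet_nonzero_kernel:
  assumes "fdet n A \<noteq> 0" and "\<And>i. i < n \<Longrightarrow> (\<Sum>j<n. A i j * t j) = 0" and "j < n"
  shows "t j = 0"
proof (rule ccontr)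
  assume "t j \<noteq> 0"
  let ?M = "mat n n (\<lambda>(i, j). A i j)"
  have "vec n t \<noteq> 0\<^sub>v n"
    using \<open>t j \<noteq> 0\<close> assms(3) by (auto simp: vec_eq_iff)
  moreover have "?M *\<^sub>v vec n t = 0\<^sub>v n"
    using assms(2) by (intro eq_vecI) (auto simp: scalar_prod_def lessThan_atLeast0)
  ultimately show False
    using assms(1) det_0_iff_vec_prod_zero[of ?M n] vec_carrier[of n t]
    unfolding fdet_def by (metis mat_carrier)
qed

lemma fdet_nonzero_solvable:
  assumes "fdet n A \<noteq> 0"
  obtains t where "\<And>i. i < n \<Longrightarrow> (\<Sum>j<n. A i j * t j) = b i"
proof -
  let ?M = "mat n n (\<lambda>(i, j). A i j)"
  have "Determinant.det ?M \<noteq> 0" "?M \<in> carrier_mat n n"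
    using assms by (auto simp: fdet_def)
  then obtain B where B: "B \<in> carrier_mat n n" "?M * B = 1\<^sub>m n"
    using det_non_zero_imp_unit[of ?M n] unfolding Units_def by (auto simp: ring_mat_def)
  define t where "t = B *\<^sub>v vec n b"
  have t: "t \<in> carrier_vec n"
    using B(1) by (simp add: t_def)
  have "?M *\<^sub>v t = vec n b"
    unfolding t_def using B by (simp add: assoc_mult_mat_vec[of _ n n _ n, symmetric])
  then have "(\<Sum>j<n. A i j * t $ j) = b i" if "i < n" for i
  proof -
    have "(?M *\<^sub>v t) $ i = (\<Sum>j<n. A i j * t $ j)"
      using that t by (simp add: scalar_prod_def lessThan_atLeast0)
    with \<open>?M *\<^sub>v t = vec n b\<close> that show ?thesis
      by simp
  qed
  then show ?thesis
    by (rule that)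
qed

text \<open>
  Cramer's rule as a linear relation between \<open>n + 1\<close> vectors \<open>v 0, \<dots>, v n\<close> of length \<open>n\<close>, to which the
  linear form with coefficients \<open>y\<close> is applied. It holds because the values of the form, placed on
  top of the matrix with columns \<open>v p\<close>, are a combination of the rows below.
\<close>

lemma cramer_relation:
  "(\<Sum>p\<le>n. (-1) ^ p * (\<Sum>a<n. y a * v p a) * fdet n (\<lambda>i. v (insert_index p i))) = 0"
proof -
  define A where "A i p = (if i = 0 then \<Sum>a<n. y a * v p a else v p (i - 1))" for i p
  have "fdet (Suc n) A = 0"
  proof (rule ccontr)
    assume "fdet (Suc n) A \<noteq> 0"
    then have nz: "fdet (Suc n) (\<lambda>p i. A i p) \<noteq> 0"
      by (simp add: fdet_transpose[of "Suc n" A])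
    have "(\<Sum>i<Suc n. A i p * (if i = 0 then -1 else y (i - 1))) = 0" for p
      by (simp add: sum.lessThan_Suc_shift A_def mult.commute del: sum.lessThan_Suc)
    from fdet_nonzero_kernel[OF nz this, of 0] show False
      by simp
  qed
  moreover have "fdet n (\<lambda>i j. A (Suc i) (insert_index p j)) = fdet n (\<lambda>i. v (insert_index p i))" for p
    by (simp add: A_def fdet_transpose[of n "\<lambda>i. v (insert_index p i)"])
  ultimately show ?thesis
    unfolding fdet_first_row by (simp add: A_def)
qed

text \<open>
  Let \<open>J\<close> consist of all vectors except the first, the \<open>q\<close>-th and the last. The functional
  \<open>x \<mapsto> det (e\<^sub>0, x, J)\<close> kills \<open>J\<close>, so applying it to the relation given by Cramer's rule leaves three
  terms only. The determinants of tails are the minors \<open>det (e\<^sub>0, \<dots>)\<close> expanded along \<open>e\<^sub>0\<close>.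
\<close>

lemma pluecker_three_term:
  fixes v :: "nat \<Rightarrow> nat \<Rightarrow> real"
  assumes q: "0 < q" "q \<le> m"
  defines "w \<equiv> \<lambda>i. v (insert_index q i)"
  shows "fdet (Suc m) w * fdet m (\<lambda>i a. v (Suc i) (Suc a)) =
      fdet (Suc m) (\<lambda>i. v (Suc i)) * fdet m (\<lambda>i a. w i (Suc a))
    + fdet (Suc m) v * fdet m (\<lambda>i a. w (Suc i) (Suc a))"
proof -
  define L where "L x = fdet m ((\<lambda>i a. w i (Suc a))(0 := \<lambda>a. x (Suc a)))" for x
  obtain C where C: "\<And>x. L x = (\<Sum>a<m. C a * x (Suc a))"
    using fdet_row_expansion[of 0 m "\<lambda>i a. w i (Suc a)"] q unfolding L_def by (metis less_le_trans)
  \<comment> \<open>\<open>L\<close> ignores entry \<open>0\<close> of \<open>x\<close>, hence the weight \<open>0\<close> there.\<close>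
  define y where "y a = (if a = 0 then 0 else C (a - 1))" for a
  have L: "L x = (\<Sum>a<Suc m. y a * x a)" for x
    by (simp add: C y_def sum.lessThan_Suc_shift del: sum.lessThan_Suc)
  have "(\<Sum>p\<le>Suc m. (-1) ^ p * L (v p) * fdet (Suc m) (\<lambda>i. v (insert_index p i))) = 0"
    unfolding L by (rule cramer_relation)
  moreover have "L (v p) = 0" if p: "p \<le> Suc m" "p \<notin> {0, q, Suc m}" for p
  proof -
    define i where "i = delete_index q p"
    have "insert_index q i = p" "0 < i" "i < m"
      using p q by (auto simp: i_def delete_index_def insert_index_def)
    then show ?thesis
      unfolding L_def using q by (intro fdet_equal_rows[of 0 m i]) (auto simp: w_def)
  qed
  ultimately have "(\<Sum>p\<in>{0, q, Suc m}. (-1) ^ p * L (v p) * fdet (Suc m) (\<lambda>i. v (insert_index p i))) = 0"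
    using q by (subst sum.mono_neutral_left[of "{..Suc m}"]) auto
  then have rel: "L (v 0) * fdet (Suc m) (\<lambda>i. v (insert_index 0 i))
      + (-1) ^ q * L (v q) * fdet (Suc m) w
      + (-1) ^ Suc m * L (v (Suc m)) * fdet (Suc m) (\<lambda>i. v (insert_index (Suc m) i)) = 0"
    using q by (simp add: w_def)
  have "L (v 0) = fdet m (\<lambda>i a. w i (Suc a))"
    unfolding L_def using q by (intro fdet_cong) (auto simp: w_def)
  moreover have "L (v q) = (-1) ^ (q - 1) * fdet m (\<lambda>i a. v (Suc i) (Suc a))"
  proof -
    have "L (v q) = fdet m (\<lambda>i. if i = 0 then (\<lambda>i a. v (Suc i) (Suc a)) (q - 1)
        else if i \<le> q - 1 then (\<lambda>i a. v (Suc i) (Suc a)) (i - 1) else (\<lambda>i a. v (Suc i) (Suc a)) i)"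
      unfolding L_def using q by (intro fdet_cong) (auto simp: w_def insert_index_def)
    then show ?thesis
      using q by (subst (asm) fdet_move_row) auto
  qed
  moreover have "L (v (Suc m)) = (-1) ^ (m - 1) * fdet m (\<lambda>i a. w (Suc i) (Suc a))"
  proof -
    have "L (v (Suc m)) = fdet m (\<lambda>i. if i = 0 then (\<lambda>i a. w (Suc i) (Suc a)) (m - 1)
        else if i \<le> m - 1 then (\<lambda>i a. w (Suc i) (Suc a)) (i - 1) else (\<lambda>i a. w (Suc i) (Suc a)) i)"
      unfolding L_def using q by (intro fdet_cong) (auto simp: w_def)
    then show ?thesis
      using q by (subst (asm) fdet_move_row) auto
  qed
  moreover have "fdet (Suc m) (\<lambda>i. v (insert_index (Suc m) i)) = fdet (Suc m) v"
    by (intro fdet_cong) auto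
  moreover have "(-1) ^ q * (-1 :: real) ^ (q - 1) = -1"
    using q by (cases q) (auto simp: power_mult_distrib[symmetric])
  moreover have "(-1) ^ Suc m * (-1 :: real) ^ (m - 1) = 1"
    using q by (cases m) (auto simp: power_mult_distrib[symmetric])
  ultimately show ?thesis
    using rel by (simp add: mult.assoc[symmetric] mult.commute)
qed

section \<open>Total positivity from minors in initial columns\<close>

lemma strict_mono_on_add_le:
  fixes r :: "nat \<Rightarrow> nat"
  assumes "strict_mono_on {..<n} r" "i + d < n"
  shows "r i + d \<le> r (i + d)"
  using assms(2)
proof (induction d)
  case (Suc d)
  then have "r (i + d) < r (i + Suc d)"
    using strict_mono_onD[OF assms(1)] by simp
  with Suc show ?case
    by simp
qed simp

lemma pick_image_strict_mono_on:
  assumes "strict_mono_on {..<n} r" "a < n"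
  shows "pick (r ` {..<n}) a = r a"
proof -
  have "{x \<in> r ` {..<n}. x < r a} = r ` {..<a}"
  proof (intro equalityI subsetI)
    fix x assume "x \<in> {x \<in> r ` {..<n}. x < r a}"
    then obtain b where "b < n" "x = r b" "r b < r a"
      by auto
    moreover from this have "b < a"
      using strict_mono_onD[OF assms(1), of a b] assms(2)
      by (metis lessThan_iff less_asym linorder_neqE_nat order_less_irrefl)
    ultimately show "x \<in> r ` {..<a}"
      by blast
  next
    fix x assume "x \<in> r ` {..<a}"
    then obtain b where "b < a" "x = r b"
      by blast
    then show "x \<in> {x \<in> r ` {..<n}. x < r a}"
      using strict_mono_onD[OF assms(1), of b a] assms(2) by simp
  qed
  moreover have "card (r ` {..<a}) = a"
    using strict_mono_on_imp_inj_on[OF assms(1)] assms(2)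
    by (subst card_image) (auto intro: inj_on_subset)
  ultimately show ?thesis
    using pick_card_in_set[of "r a" "r ` {..<n}"] assms(2) by simp
qed

text \<open>
  Increasing sequences \<open>r\<close> and \<open>c\<close> represent the sets of rows and columns of a minor: they are easier
  to border, shift and shorten than the sets themselves.
\<close>

lemma minor_image:
  assumes "u \<in> carrier_mat N N"
    and r: "strict_mono_on {..<n} r" "r ` {..<n} \<subseteq> {..<N}"
    and c: "strict_mono_on {..<n} c" "c ` {..<n} \<subseteq> {..<N}"
  shows "minor u (r ` {..<n}) (c ` {..<n}) = fdet n (\<lambda>i j. u $$ (r i, c j))"
proof -
  have card: "card (r ` {..<n}) = n" "card (c ` {..<n}) = n"
    using r(1) c(1) by (simp_all add: card_image strict_mono_on_imp_inj_on)
  show ?thesis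
    using minor_eq[OF assms(1) r(2) c(2)] fdet_cong[of n "\<lambda>i j. u $$ (pick (r ` {..<n}) i, pick (c ` {..<n}) j)"]
    by (simp add: card fdet_def[symmetric] pick_image_strict_mono_on r c)
qed

lemma lower_unipotent_vanishing_minor:
  assumes u: "u \<in> lower_unipotent N"
    and r: "strict_mono_on {..<n} r" "r ` {..<n} \<subseteq> {..<N}"
    and c: "strict_mono_on {..<n} c" "c ` {..<n} \<subseteq> {..<N}"
    and a: "a < n" "r a < c a"
  shows "fdet n (\<lambda>i j. u $$ (r i, c j)) = 0"
proof (rule ccontr)
  assume "\<not> ?thesis"
  then have "\<exists>w\<in>lower_unipotent N. minor w (r ` {..<n}) (c ` {..<n}) \<noteq> 0"
    using minor_image[OF _ r c, of u] u by (auto simp: lower_unipotent_def)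
  moreover have "card (r ` {..<n}) = n" "card (c ` {..<n}) = n"
    using r(1) c(1) by (simp_all add: card_image strict_mono_on_imp_inj_on)
  ultimately have "pick (c ` {..<n}) a \<le> pick (r ` {..<n}) a"
    using nonvanishing_minor_iff[OF r(2) c(2)] a(1) by simp
  then show False
    using a by (simp add: pick_image_strict_mono_on r c)
qed

definition flag_minors_positive :: "nat \<Rightarrow> real mat \<Rightarrow> bool" where
  "flag_minors_positive N u \<longleftrightarrow>
     (\<forall>m r. strict_mono_on {..<m} r \<longrightarrow> r ` {..<m} \<subseteq> {..<N} \<longrightarrow> fdet m (\<lambda>i j. u $$ (r i, j)) > 0)"

text \<open>
  The induction on the first column \<open>j\<close> adds row and column \<open>j\<close>: as row \<open>j\<close> of \<open>u\<close> is \<open>1\<close> at \<open>j\<close> and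
  vanishes to the right of it, this does not change the minor.
\<close>

lemma consecutive_columns_positive:
  assumes u: "u \<in> lower_unipotent N" and pos: "flag_minors_positive N u"
    and "strict_mono_on {..<n} r" "r ` {..<n} \<subseteq> {..<N}" "\<And>i. i < n \<Longrightarrow> j \<le> r i"
  shows "fdet n (\<lambda>i b. u $$ (r i, j + b)) > 0"
  using assms(3-)
proof (induction j arbitrary: n r)
  case 0
  then show ?case
    using pos by (simp add: flag_minors_positive_def)
next
  case (Suc j)
  show ?case
  proof (cases n)
    case (Suc m)
    have rN: "r i < N" if "i < n" for i
      using Suc.prems(2) that by auto
    have "r 0 + m \<le> r m"
      using strict_mono_on_add_le[OF Suc.prems(1), of 0 m] Suc by simp
    then have jn: "j + n < N"
      using Suc.prems(3)[of 0] rN[of m] Suc by simp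
    define r' where "r' i = (if i = 0 then j else r (i - 1))" for i
    have "strict_mono_on {..<Suc n} r'"
    proof (rule strict_mono_onI)
      fix i i' assume "i \<in> {..<Suc n}" "i' \<in> {..<Suc n}" "i < i'"
      then show "r' i < r' i'"
        using strict_mono_onD[OF Suc.prems(1), of "i - 1" "i' - 1"] Suc.prems(3)[of "i' - 1"]
        by (cases i'; cases i) (auto simp: r'_def)
    qed
    moreover have "r' ` {..<Suc n} \<subseteq> {..<N}"
      using rN jn by (auto simp: r'_def)
    moreover have "j \<le> r' i" if "i < Suc n" for i
      using Suc.prems(3)[of "i - 1"] that by (cases i) (auto simp: r'_def)
    ultimately have "0 < fdet (Suc n) (\<lambda>i b. u $$ (r' i, j + b))"
      by (rule Suc.IH)
    also have "\<dots> = u $$ (j, j) * fdet n (\<lambda>i b. u $$ (r i, Suc j + b))"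
      using u jn by (subst fdet_first_row_single[of 0]) (auto simp: r'_def lower_unipotent_def)
    also have "u $$ (j, j) = 1"
      using u jn by (simp add: lower_unipotent_def)
    finally show ?thesis
      by simp
  qed simp
qed

text \<open>
  The induction is on the size of the minor and then on the width \<open>c m - c 0\<close> of its set of columns.
  If a column \<open>l\<close> is missing between \<open>c 0\<close> and \<open>c m\<close>, let \<open>c'\<close> be \<open>c\<close> with \<open>l\<close> inserted. The three-term
  relation for \<open>c 0\<close>, \<open>l\<close>, \<open>c m\<close> expresses the minor through three smaller minors, which lack the
  first row, and the minors in the columns \<open>c' 0, \<dots>, c' m\<close> and \<open>c' 1, \<dots>, c' (m + 1)\<close>, which have
  smaller width. Lacking the first row keeps the smaller minors in the nonvanishing range
  \<open>c i \<le> r i\<close>. Only the minor in the columns \<open>c' 1, \<dots>, c' (m + 1)\<close> may leave it, and then it is zero.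
\<close>

lemma unipotent_minor_positive:
  assumes u: "u \<in> lower_unipotent N" and pos: "flag_minors_positive N u"
    and "strict_mono_on {..<n} r" "r ` {..<n} \<subseteq> {..<N}"
    and "strict_mono_on {..<n} c" "c ` {..<n} \<subseteq> {..<N}"
    and "\<And>i. i < n \<Longrightarrow> c i \<le> r i"
  shows "fdet n (\<lambda>i j. u $$ (r i, c j)) > 0"
  using assms(3-)
proof (induction n arbitrary: r c)
  case (Suc m)
  note r = Suc.prems(1,2)
  have rless: "r i < r j" if "i < j" "j \<le> m" for i j
    using strict_mono_onD[OF r(1)] that by auto
  have rN: "r i < N" if "i \<le> m" for i
    using image_subset_iff[of r "{..<Suc m}"] r(2) that by simp
  show ?case
    using Suc.prems(3-)
  proof (induction "c m - c 0" arbitrary: c rule: less_induct)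
    case less
    have cless: "c i < c j" if "i < j" "j \<le> m" for i j
      using strict_mono_onD[OF less.prems(1)] that by auto
    have cN: "c i < N" if "i \<le> m" for i
      using image_subset_iff[of c "{..<Suc m}"] less.prems(2) that by simp
    show ?case
    proof (cases "\<exists>l. c 0 < l \<and> l < c m \<and> l \<notin> c ` {..m}")
      case False
      have "c b = c 0 + b" if "b \<le> m" for b
        using that
      proof (induction b)
        case (Suc b)
        then have "c (Suc b) \<le> Suc (c b)"
        proof -
          have "c 0 < Suc (c b)"
            using Suc by simp
          moreover have "Suc (c b) \<notin> c ` {..m}" if "Suc (c b) < c (Suc b)"
          proof
            assume "Suc (c b) \<in> c ` {..m}"
            then obtain i where i: "i \<le> m" "c i = Suc (c b)"
              by auto
            then show False
              using that cless[of i b] cless[of "Suc b" i] Suc.prems by (cases i "Suc b" rule: linorder_cases) (auto simp: less_Suc_eq)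
          qed
          moreover have "c (Suc b) \<le> c m"
            using cless[of "Suc b" m] Suc.prems by (cases "Suc b = m") auto
          ultimately show ?thesis
            using False by (meson not_le less_le_trans)
        qed
        then show ?case
          using Suc cless[of b "Suc b"] by simp
      qed simp
      then have "fdet (Suc m) (\<lambda>i j. u $$ (r i, c j)) = fdet (Suc m) (\<lambda>i j. u $$ (r i, c 0 + j))"
        by (intro fdet_cong) (metis less_Suc_eq_le)
      also have "\<dots> > 0"
      proof (rule consecutive_columns_positive[OF u pos r])
        fix i assume "i < Suc m"
        then show "c 0 \<le> r i"
          using less.prems(3)[of 0] rless[of 0 i] by (cases "i = 0") auto
      qed
      finally show ?thesis .
    next
      case True
      then obtain l where l: "c 0 < l" "l < c m" "\<And>i. i \<le> m \<Longrightarrow> c i \<noteq> l"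
        by auto
      define q where "q = (LEAST i. l < c i)"
      have lq: "l < c q"
        unfolding q_def by (rule LeastI[of _ m]) (rule l(2))
      have q_least: "q \<le> i" if "l < c i" for i
        unfolding q_def using that by (rule Least_le)
      have q: "0 < q" "q \<le> m"
        using lq l(1) q_least[OF l(2)] by (cases "q = 0"; simp)+
      have below: "c i < l" if "i < q" for i
        using q_least[of i] l(3)[of i] that q by linarith
      define c' where "c' i = (if i < q then c i else if i = q then l else c (i - 1))" for i
      have c_eq: "c = (\<lambda>i. c' (insert_index q i))"
        by (rule ext) (auto simp: c'_def insert_index_def)
      have c'less: "c' i < c' j" if "i < j" "j \<le> Suc m" for i j
      proof -
        have "c q \<le> c (j - 1)" if "q < j"
        proof -
          have "q = j - 1 \<or> q < j - 1"
            using that by linarith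
          then show ?thesis
            using cless[of q "j - 1"] \<open>j \<le> Suc m\<close> by (auto intro: less_imp_le)
        qed
        moreover have "i < q \<Longrightarrow> c i < l"
          by (rule below)
        ultimately show ?thesis
          using that lq cless[of i j] cless[of i "j - 1"] cless[of "i - 1" "j - 1"] q
          by (auto simp: c'_def)
      qed
      have c'N: "c' i < N" if "i \<le> Suc m" for i
        using that cN[of i] cN[of "i - 1"] lq cN[of q] q by (auto simp: c'_def)
      have c'c: "c' i \<le> c i" if "i \<le> m" for i
        using that lq cless[of "i - 1" i] q by (auto simp: c'_def)
      have cr: "c i \<le> r i" if "i \<le> m" for i
        using less.prems(3) that by simp
      have rSuc: "strict_mono_on {..<m} (\<lambda>i. r (Suc i))" "(\<lambda>i. r (Suc i)) ` {..<m} \<subseteq> {..<N}"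
        using rless rN by (auto intro!: strict_mono_onI)
      have IH: "fdet m (\<lambda>i j. u $$ (r (Suc i), d j)) > 0"
        if "\<And>i j. i < j \<Longrightarrow> j < m \<Longrightarrow> d i < d j" "\<And>i. i < m \<Longrightarrow> d i \<le> c (Suc i)" for d
      proof (rule Suc.IH[OF rSuc])
        show "strict_mono_on {..<m} d"
          using that(1) by (auto intro!: strict_mono_onI)
        show "d ` {..<m} \<subseteq> {..<N}"
          using le_less_trans[OF that(2) cN] by (auto simp: Suc_le_eq)
        show "d i \<le> r (Suc i)" if "i < m" for i
          using \<open>\<And>i. i < m \<Longrightarrow> d i \<le> c (Suc i)\<close>[of i] cr[of "Suc i"] that by simp
      qed
      have tr: "fdet n (\<lambda>i a. u $$ (r' a, d i)) = fdet n (\<lambda>i j. u $$ (r' i, d j))" for n r' d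
        by (rule fdet_transpose)
      have "fdet (Suc m) (\<lambda>i j. u $$ (r i, c j)) * fdet m (\<lambda>i j. u $$ (r (Suc i), c' (Suc j)))
          = fdet (Suc m) (\<lambda>i j. u $$ (r i, c' (Suc j))) * fdet m (\<lambda>i j. u $$ (r (Suc i), c j))
          + fdet (Suc m) (\<lambda>i j. u $$ (r i, c' j)) * fdet m (\<lambda>i j. u $$ (r (Suc i), c (Suc j)))"
        using pluecker_three_term[OF q, of "\<lambda>p a. u $$ (r a, c' p)"]
        unfolding tr c_eq[symmetric] by (simp add: fun_cong[OF c_eq, symmetric] tr)
      moreover have "fdet m (\<lambda>i j. u $$ (r (Suc i), c' (Suc j))) > 0"
        by (rule IH) (use c'less c'c in auto)
      moreover have "fdet m (\<lambda>i j. u $$ (r (Suc i), c j)) > 0"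
        by (rule IH) (use cless in \<open>auto intro: less_imp_le\<close>)
      moreover have "fdet m (\<lambda>i j. u $$ (r (Suc i), c (Suc j))) > 0"
        by (rule IH) (use cless in auto)
      moreover have "fdet (Suc m) (\<lambda>i j. u $$ (r i, c' j)) > 0"
      proof (rule less.hyps)
        have "c' m < c m" "c' 0 = c 0"
          using c'less[of m "Suc m"] q by (auto simp: c'_def)
        moreover have "c' 0 \<le> c' m"
          using c'less[of 0 m] by (cases m) auto
        ultimately show "c' m - c' 0 < c m - c 0"
          by simp
        show "strict_mono_on {..<Suc m} c'" "c' ` {..<Suc m} \<subseteq> {..<N}"
          using c'less c'N by (auto intro!: strict_mono_onI)
        show "c' i \<le> r i" if "i < Suc m" for i
          using c'c[of i] cr[of i] that by simp
      qed
      moreover have "fdet (Suc m) (\<lambda>i j. u $$ (r i, c' (Suc j))) \<ge> 0"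
      proof -
        have mono: "strict_mono_on {..<Suc m} (\<lambda>i. c' (Suc i))" "(\<lambda>i. c' (Suc i)) ` {..<Suc m} \<subseteq> {..<N}"
          using c'less c'N by (auto intro!: strict_mono_onI)
        show ?thesis
        proof (cases "\<forall>i<Suc m. c' (Suc i) \<le> r i")
          case True
          have "c' (Suc m) = c m" "c' (Suc 0) > c 0"
            using q c'less[of 0 "Suc 0"] by (auto simp: c'_def)
          moreover have "c 0 < c m"
            using l by simp
          ultimately have "c' (Suc m) - c' (Suc 0) < c m - c 0"
            by simp
          then show ?thesis
            using less.hyps[of "\<lambda>i. c' (Suc i)"] mono True by (simp add: less_imp_le)
        next
          case False
          then show ?thesis
            using lower_unipotent_vanishing_minor[OF u r mono] by force
        qed
      qed
      ultimately show ?thesis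
        by (smt (verit) mult_nonneg_nonneg mult_pos_pos zero_less_mult_pos2)
    qed
  qed
qed simp

lemma totally_positive_unipotentI:
  assumes u: "u \<in> lower_unipotent N" and pos: "flag_minors_positive N u"
  shows "u \<in> totally_positive_unipotent N"
proof -
  have "minor u I J > 0"
    if "I \<subseteq> {..<N}" "J \<subseteq> {..<N}" "card I = card J" "\<exists>w\<in>lower_unipotent N. minor w I J \<noteq> 0" for I J
  proof -
    have mono: "strict_mono_on {..<card K} (pick K)" for K
      by (auto intro!: strict_mono_onI simp: pick_mono_le)
    have "pick K ` {..<m} \<subseteq> {..<N}" if "K \<subseteq> {..<N}" "card K = m" for K m
      using pick_lt_bound[OF that(1)] that(2) by auto
    then have "fdet (card I) (\<lambda>i j. u $$ (pick I i, pick J j)) > 0"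
      using that nonvanishing_minor_iff[OF that(1-3)] mono[of I] mono[of J]
      by (intro unipotent_minor_positive[OF u pos]) simp_all
    then show ?thesis
      using u that by (simp add: minor_eq[of u N] lower_unipotent_def fdet_def)
  qed
  then show ?thesis
    using u by (auto simp: totally_positive_unipotent_def)
qed

section \<open>Determinants as functionals on the exterior algebra\<close>

lemma lookup_scaleR: "Poly_Mapping.lookup (c *\<^sub>R x) i = c *\<^sub>R Poly_Mapping.lookup x i"
proof -
  have "finite {i. c *\<^sub>R Poly_Mapping.lookup x i \<noteq> 0}"
    by (rule finite_subset[OF _ finite_keys[of x]]) (auto simp: in_keys_iff)
  then show ?thesis
    by (simp add: scaleR_poly_mapping_def Abs_poly_mapping_inverse)
qed

text \<open>
  Lists form a basis of the free vector space on them, so a linear functional may be prescribed on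
  lists.
\<close>

lemma linear_functional_on_lists:
  fixes F :: "'v list \<Rightarrow> real"
  obtains \<psi> :: "('v list \<Rightarrow>\<^sub>0 real) \<Rightarrow> real" where "linear \<psi>" "\<And>vs. \<psi> (free_vec vs) = F vs"
proof
  define \<psi> where "\<psi> x = Sum_any (\<lambda>vs. Poly_Mapping.lookup x vs * F vs)" for x
  have fin: "finite {vs. Poly_Mapping.lookup x vs * F vs \<noteq> 0}" for x :: "'v list \<Rightarrow>\<^sub>0 real"
    by (rule finite_subset[OF _ finite_keys[of x]]) (auto simp: in_keys_iff)
  show "linear \<psi>"
  proof (rule linearI)
    fix x y
    show "\<psi> (x + y) = \<psi> x + \<psi> y"
      unfolding \<psi>_def by (simp add: lookup_add distrib_right Sum_any.distrib[OF fin fin])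
  next
    fix r :: real and x
    have "\<psi> (r *\<^sub>R x) = Sum_any (\<lambda>vs. r * (Poly_Mapping.lookup x vs * F vs))"
      unfolding \<psi>_def by (simp add: lookup_scaleR mult.assoc)
    then show "\<psi> (r *\<^sub>R x) = r *\<^sub>R \<psi> x"
      using Sum_any_right_distrib[OF fin, of r x] by (simp add: \<psi>_def)
  qed
  fix vs
  have "(\<lambda>ws. Poly_Mapping.lookup (free_vec vs) ws * F ws) = (\<lambda>ws. if ws = vs then F ws else 0)"
    by (auto simp: lookup_single fun_eq_iff when_def)
  moreover have "Sum_any (\<lambda>ws. if ws = vs then F ws else 0) = F vs"
    by (subst Sum_any.expand_superset[of "{vs}"]) auto
  ultimately show "\<psi> (free_vec vs) = F vs"
    unfolding \<psi>_def by metis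
qed

lemma exterior_functional:
  fixes F :: "'v::real_vector list \<Rightarrow> real"
  assumes add: "\<And>xs u v ys. F (xs @ (u + v) # ys) = F (xs @ u # ys) + F (xs @ v # ys)"
    and scale: "\<And>xs c v ys. F (xs @ (c *\<^sub>R v) # ys) = c * F (xs @ v # ys)"
    and alt: "\<And>xs v ys. F (xs @ v # v # ys) = 0"
  obtains \<phi> :: "'v exterior \<Rightarrow> real" where "linear \<phi>" "\<And>vs. \<phi> (wedge vs) = F vs"
proof -
  obtain \<psi> :: "('v list \<Rightarrow>\<^sub>0 real) \<Rightarrow> real" where \<psi>: "linear \<psi>" "\<And>vs. \<psi> (free_vec vs) = F vs"
    using linear_functional_on_lists by blast
  have "\<psi> r = 0" if "r \<in> exterior_relations" for r
    using that unfolding exterior_relations_def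
    by (auto simp: linear_diff[OF \<psi>(1)] linear_cmul[OF \<psi>(1)] \<psi>(2) add scale alt)
  then have "\<psi> r = 0" if "r \<in> span exterior_relations" for r
    using linear_eq_0_on_span[OF \<psi>(1) _ that] by blast
  then have well_defined: "\<psi> x = \<psi> y" if "exterior_eq x y" for x y
    using that linear_diff[OF \<psi>(1), of x y] by (simp add: exterior_eq_def)
  define \<phi> where "\<phi> X = \<psi> (rep_exterior X)" for X
  have \<phi>_abs: "\<phi> (abs_exterior x) = \<psi> x" for x
    unfolding \<phi>_def by (intro well_defined) (metis Quotient3_exterior Quotient3_def exterior.abs_eq_iff)
  have "linear \<phi>"
  proof (rule linearI)
    fix X Y :: "'v exterior" and c :: real
    obtain x y where X: "X = abs_exterior x" "Y = abs_exterior y"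
      using Quotient3_abs_rep[OF Quotient3_exterior] by metis
    show "\<phi> (X + Y) = \<phi> X + \<phi> Y"
      unfolding X plus_exterior.abs_eq \<phi>_abs by (rule linear_add[OF \<psi>(1)])
    show "\<phi> (c *\<^sub>R X) = c *\<^sub>R \<phi> X"
      unfolding X scaleR_exterior.abs_eq \<phi>_abs by (rule linear_cmul[OF \<psi>(1)])
  qed
  moreover have "\<phi> (wedge vs) = F vs" for vs
    unfolding wedge.abs_eq \<phi>_abs by (rule \<psi>(2))
  ultimately show ?thesis
    by (rule that)
qed

lemma determinant_functional:
  fixes f :: "nat \<Rightarrow> 'v::real_vector \<Rightarrow> real"
  assumes f: "\<And>a. a < m \<Longrightarrow> linear (f a)"
  shows "\<exists>\<phi> :: 'v exterior \<Rightarrow> real. linear \<phi> \<and>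
    (\<forall>b. \<phi> (wedge (map b [0..<m])) = fdet m (\<lambda>a i. f a (b i)))"
proof -
  define D where "D vs = fdet m (\<lambda>i a. f a (vs ! i))" for vs
  define F where "F vs = (if length vs = m then D vs else 0)" for vs
  have row: "\<exists>C. \<forall>v. D (xs @ v # ys) = (\<Sum>a<m. C a * f a v)" if "length xs + Suc (length ys) = m" for xs ys
  proof -
    have q: "length xs < m"
      using that by simp
    obtain C where C: "\<And>y. fdet m ((\<lambda>i a. f a ((xs @ 0 # ys) ! i))(length xs := y)) = (\<Sum>a<m. C a * y a)"
      using fdet_row_expansion[OF q] by blast
    have "D (xs @ v # ys) = fdet m ((\<lambda>i a. f a ((xs @ 0 # ys) ! i))(length xs := \<lambda>a. f a v))" for v
      unfolding D_def by (intro fdet_cong) (auto simp: nth_append nth_Cons split: nat.split)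
    then show ?thesis
      unfolding C by blast
  qed
  have "F (xs @ (u + v) # ys) = F (xs @ u # ys) + F (xs @ v # ys)" for xs u v ys
  proof (cases "length xs + Suc (length ys) = m")
    case True
    obtain C where C: "\<And>v. D (xs @ v # ys) = (\<Sum>a<m. C a * f a v)"
      using row[OF True] by blast
    have "F (xs @ v # ys) = (\<Sum>a<m. C a * f a v)" for v
      using True C by (simp add: F_def)
    then show ?thesis
      by (simp add: linear_add[OF f] distrib_left sum.distrib)
  qed (simp add: F_def)
  moreover have "F (xs @ (c *\<^sub>R v) # ys) = c * F (xs @ v # ys)" for xs c v ys
  proof (cases "length xs + Suc (length ys) = m")
    case True
    obtain C where C: "\<And>v. D (xs @ v # ys) = (\<Sum>a<m. C a * f a v)"
      using row[OF True] by blast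
    have "F (xs @ v # ys) = (\<Sum>a<m. C a * f a v)" for v
      using True C by (simp add: F_def)
    then show ?thesis
      by (simp add: linear_cmul[OF f] sum_distrib_left mult.left_commute)
  qed (simp add: F_def)
  moreover have "F (xs @ v # v # ys) = 0" for xs v ys
    unfolding F_def D_def
    using fdet_equal_rows[of "length xs" m "Suc (length xs)" "\<lambda>i a. f a ((xs @ v # v # ys) ! i)"]
    by (auto simp: nth_append)
  ultimately obtain \<phi> :: "'v exterior \<Rightarrow> real" where \<phi>: "linear \<phi>" "\<And>vs. \<phi> (wedge vs) = F vs"
    using exterior_functional[of F] by blast
  have "D (map b [0..<m]) = fdet m (\<lambda>i a. f a (b i))" for b
    unfolding D_def by (intro fdet_cong) simp
  then have "\<phi> (wedge (map b [0..<m])) = fdet m (\<lambda>a i. f a (b i))" for b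
    unfolding \<phi>(2) by (simp add: F_def fdet_transpose[of m "\<lambda>a i. f a (b i)"])
  with \<phi>(1) show ?thesis
    by blast
qed

lemma wedge_swap: "wedge (xs @ v # w # ys) = - wedge (xs @ w # v # ys)"
proof -
  have "0 = wedge (xs @ (v + w) # (v + w) # ys)"
    by (simp add: wedge_alternating)
  also have "\<dots> = wedge (xs @ v # v # ys) + wedge (xs @ v # w # ys)
      + (wedge (xs @ w # v # ys) + wedge (xs @ w # w # ys))"
    using wedge_add[of xs v w "(v + w) # ys"] wedge_add[of "xs @ [v]" v w ys] wedge_add[of "xs @ [w]" v w ys]
    by simp
  finally show ?thesis
    by (simp add: wedge_alternating eq_neg_iff_add_eq_0)
qed

lemma wedge_move_back: "\<exists>s. wedge (xs @ v # ys @ zs) = s *\<^sub>R wedge (xs @ ys @ v # zs)"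
proof (induction ys arbitrary: xs)
  case Nil
  show ?case
    by (auto intro: exI[of _ 1])
next
  case (Cons y ys)
  obtain s where "wedge ((xs @ [y]) @ v # ys @ zs) = s *\<^sub>R wedge ((xs @ [y]) @ ys @ v # zs)"
    using Cons by blast
  then have "wedge (xs @ v # (y # ys) @ zs) = (- s) *\<^sub>R wedge (xs @ (y # ys) @ v # zs)"
    using wedge_swap[of xs v y "ys @ zs"] by simp
  then show ?case
    by blast
qed

text \<open>
  Only proportionality is claimed: the scalar is the sign of the permutation, but its value is
  irrelevant for membership in a span.
\<close>

lemma wedge_permute: "mset xs = mset ys \<Longrightarrow> \<exists>s. wedge (zs @ xs) = s *\<^sub>R wedge (zs @ ys)"
proof (induction xs arbitrary: ys zs)
  case Nil
  then show ?case
    by (auto intro: exI[of _ 1])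
next
  case (Cons x xs)
  have "x \<in> set ys"
    using Cons.prems by (metis list.set_intros(1) set_mset_mset)
  then obtain ys1 ys2 where ys: "ys = ys1 @ x # ys2"
    by (meson split_list)
  obtain s where s: "wedge ((zs @ [x]) @ xs) = s *\<^sub>R wedge ((zs @ [x]) @ ys1 @ ys2)"
    using Cons.IH[of "ys1 @ ys2" "zs @ [x]"] Cons.prems ys by auto
  obtain t where "wedge (zs @ x # ys1 @ ys2) = t *\<^sub>R wedge (zs @ ys1 @ x # ys2)"
    using wedge_move_back by blast
  then show ?case
    using s ys by (auto intro!: exI[of _ "s * t"])
qed

lemma wedge_indexed_in_span:
  assumes "set is \<subseteq> {..<n}" "length is = m"
  shows "wedge (map b is) \<in> span (wedge_basis b ` {I. I \<subseteq> {..<n} \<and> card I = m})"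
proof (cases "distinct is")
  case True
  have "mset is = mset (sorted_list_of_set (set is))"
    using True set_eq_iff_mset_eq_distinct[of "is" "sorted_list_of_set (set is)"] by simp
  then have "mset (map b is) = mset (map b (sorted_list_of_set (set is)))"
    by (simp only: mset_map)
  then obtain s where "wedge ([] @ map b is) = s *\<^sub>R wedge ([] @ map b (sorted_list_of_set (set is)))"
    using wedge_permute by blast
  moreover have "set is \<in> {I. I \<subseteq> {..<n} \<and> card I = m}"
    using assms distinct_card[OF True] by simp
  ultimately show ?thesis
    unfolding wedge_basis_def by (simp add: span_scale span_base)
next
  case False
  then obtain xs ys zs y where "is = xs @ [y] @ ys @ [y] @ zs"
    using not_distinct_decomp by blast
  then have "mset (map b is) = mset (b y # b y # map b (xs @ ys @ zs))"
    by simp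
  then obtain s where "wedge ([] @ map b is) = s *\<^sub>R wedge ([] @ b y # b y # map b (xs @ ys @ zs))"
    using wedge_permute by blast
  then show ?thesis
    using wedge_alternating[of "[]" "b y" "map b (xs @ ys @ zs)"] by (simp add: span_zero)
qed

text \<open>
  The entries of \<open>vs\<close> are replaced by vectors \<open>b i\<close> one after the other, from left to right: for fixed
  other entries, the vectors whose product lies in the span form a subspace.
\<close>

lemma wedge_in_span:
  fixes b :: "nat \<Rightarrow> 'v::real_vector"
  assumes "set vs \<subseteq> span (b ` {..<n})" "length vs = m"
  shows "wedge vs \<in> span (wedge_basis b ` {I. I \<subseteq> {..<n} \<and> card I = m})"
    (is "_ \<in> span ?S")
proof -
  have "wedge (map b is @ vs) \<in> span ?S"
    if "set is \<subseteq> {..<n}" "length is + length vs = m" "set vs \<subseteq> span (b ` {..<n})" for "is" vs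
    using that
  proof (induction vs arbitrary: "is")
    case Nil
    then show ?case
      using wedge_indexed_in_span[of "is" n m b] by simp
  next
    case (Cons v vs)
    let ?T = "{v. wedge (map b is @ v # vs) \<in> span ?S}"
    have zero: "wedge (map b is @ 0 # vs) = 0"
      using wedge_scaleR[of "map b is" 0 0 vs] by simp
    have "subspace ?T"
      by (auto intro!: subspaceI simp: wedge_add wedge_scaleR zero span_zero span_add span_scale)
    moreover have "b ` {..<n} \<subseteq> ?T"
      using Cons.IH[of "is @ [_]"] Cons.prems by auto
    ultimately have "span (b ` {..<n}) \<subseteq> ?T"
      by (rule span_minimal[rotated])
    then show ?case
      using Cons.prems by auto
  qed
  from this[of "[]" vs] show ?thesis
    using assms by simp
qed

lemma wedge_span_singleton:
  assumes "set vs \<subseteq> span (b ` {..<m})" "length vs = m"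
  shows "wedge vs \<in> span {wedge (map b [0..<m])}"
proof -
  have "{I. I \<subseteq> {..<m} \<and> card I = m} = {{..<m}}"
    using card_subset_eq[of "{..<m}"] by auto
  moreover have "wedge_basis b {..<m} = wedge (map b [0..<m])"
    by (simp add: wedge_basis_def lessThan_atLeast0)
  ultimately show ?thesis
    using wedge_in_span[OF assms] by simp
qed

lemma exterior_power_span:
  "exterior_power m (span (b ` {..<m})) = span {wedge (map b [0..<m])}"
  unfolding exterior_power_def
proof (rule span_eq[THEN iffD2], intro conjI)
  show "wedge ` {vs. length vs = m \<and> set vs \<subseteq> span (b ` {..<m})} \<subseteq> span {wedge (map b [0..<m])}"
    using wedge_span_singleton by blast
  have "wedge (map b [0..<m]) \<in> wedge ` {vs. length vs = m \<and> set vs \<subseteq> span (b ` {..<m})}"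
    by (intro imageI) (auto intro: span_base)
  then show "{wedge (map b [0..<m])} \<subseteq> span (wedge ` {vs. length vs = m \<and> set vs \<subseteq> span (b ` {..<m})})"
    by (simp add: span_base)
qed

text \<open>
  \<open>\<Lambda>\<^sup>m\<close> of the span of \<open>m\<close> vectors is at most a line, and every determinant in \<open>m\<close> linear forms is a
  functional on it. One scalar \<open>s\<close> serves all choices \<open>f\<close> of linear forms.
\<close>

lemma minors_proportional:
  fixes b c :: "nat \<Rightarrow> 'v::real_vector"
  assumes "\<And>j. j < m \<Longrightarrow> c j \<in> span (b ` {..<m})"
  obtains s where
    "\<And>f. (\<And>a. a < m \<Longrightarrow> linear (f a)) \<Longrightarrow> fdet m (\<lambda>a i. f a (c i)) = s * fdet m (\<lambda>a i. f a (b i))"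
proof -
  have "wedge (map c [0..<m]) \<in> span {wedge (map b [0..<m])}"
    using assms by (intro wedge_span_singleton) auto
  then obtain s where s: "wedge (map c [0..<m]) = s *\<^sub>R wedge (map b [0..<m])"
    by (auto simp: span_singleton)
  have "fdet m (\<lambda>a i. f a (c i)) = s * fdet m (\<lambda>a i. f a (b i))"
    if f: "\<And>a. a < m \<Longrightarrow> linear (f a)" for f :: "nat \<Rightarrow> 'v \<Rightarrow> real"
  proof -
    have "\<exists>\<phi> :: 'v exterior \<Rightarrow> real. linear \<phi> \<and>
        (\<forall>b. \<phi> (wedge (map b [0..<m])) = fdet m (\<lambda>a i. f a (b i)))"
      using f by (rule determinant_functional)
    then obtain \<phi> :: "'v exterior \<Rightarrow> real" where \<phi>: "linear \<phi>"
        "\<And>b. \<phi> (wedge (map b [0..<m])) = fdet m (\<lambda>a i. f a (b i))"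
      by blast
    have "\<phi> (wedge (map c [0..<m])) = s * \<phi> (wedge (map b [0..<m]))"
      unfolding s linear_cmul[OF \<phi>(1)] by simp
    then show ?thesis
      unfolding \<phi>(2) .
  qed
  then show ?thesis
    by (rule that)
qed

text \<open>
  A family with a dual family is injective and independent, so that \<open>representation\<close> does not take
  its default value \<open>0\<close> for dependent sets.
\<close>

lemma dual_functionals:
  fixes \<beta> :: "'i \<Rightarrow> 'w::real_vector" and \<phi> :: "'i \<Rightarrow> 'w \<Rightarrow> real"
  assumes fin: "finite K" and lin: "\<And>i. i \<in> K \<Longrightarrow> linear (\<phi> i)"
    and dual: "\<And>i j. i \<in> K \<Longrightarrow> j \<in> K \<Longrightarrow> \<phi> i (\<beta> j) = (if i = j then 1 else 0)"
    and \<omega>: "\<omega> \<in> span (\<beta> ` K)" and i: "i \<in> K"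
  shows "representation (\<beta> ` K) \<omega> (\<beta> i) = \<phi> i \<omega>"
proof -
  have inj: "inj_on \<beta> K"
    using dual by (intro inj_onI) (metis zero_neq_one)
  have apply_sum: "\<phi> i (\<Sum>v\<in>\<beta> ` K. g v *\<^sub>R v) = g (\<beta> i)" if "i \<in> K" for g i
  proof -
    have "\<phi> i (\<Sum>v\<in>\<beta> ` K. g v *\<^sub>R v) = (\<Sum>j\<in>K. g (\<beta> j) * \<phi> i (\<beta> j))"
      by (simp add: linear_sum[OF lin] linear_cmul[OF lin] sum.reindex[OF inj] that)
    also have "\<dots> = (\<Sum>j\<in>K. if i = j then g (\<beta> j) else 0)"
      using that dual by (intro sum.cong) auto
    finally show ?thesis
      using that fin by simp
  qed
  have indep: "independent (\<beta> ` K)"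
  proof (rule independent_if_scalars_zero)
    fix g v assume g: "(\<Sum>v\<in>\<beta> ` K. g v *\<^sub>R v) = 0" and "v \<in> \<beta> ` K"
    then obtain i where i: "i \<in> K" "v = \<beta> i"
      by blast
    then show "g v = 0"
      using apply_sum[OF i(1), of g] linear_0[OF lin[OF i(1)]] unfolding g by simp
  qed (use fin in simp)
  have "(\<Sum>v\<in>\<beta> ` K. representation (\<beta> ` K) \<omega> v *\<^sub>R v) = \<omega>"
    using sum_representation_eq[OF indep \<omega>, of "\<beta> ` K"] fin by simp
  with apply_sum[OF i, of "representation (\<beta> ` K) \<omega>"] show ?thesis
    by simp
qed

definition coord :: "nat \<Rightarrow> (nat \<Rightarrow> 'v::real_vector) \<Rightarrow> nat \<Rightarrow> 'v \<Rightarrow> real" where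
  "coord N e i v = representation (e ` {..<N}) v (e i)"

lemma linear_coord:
  assumes "ordered_basis N e"
  shows "linear (coord N e i)"
  using assms unfolding ordered_basis_def coord_def
  by (intro linearI) (simp_all add: representation_add representation_scale)

lemma coord_basis:
  assumes "ordered_basis N e" "i < N" "j < N"
  shows "coord N e i (e j) = (if i = j then 1 else 0)"
  using assms unfolding ordered_basis_def coord_def
  by (auto simp: representation_basis inj_on_eq_iff)

lemma coord_sum:
  assumes "ordered_basis N e"
  shows "(\<Sum>i<N. coord N e i v *\<^sub>R e i) = v"
proof -
  have e: "inj_on e {..<N}" "independent (e ` {..<N})" "span (e ` {..<N}) = UNIV"
    using assms by (auto simp: ordered_basis_def)
  have "v = (\<Sum>w\<in>e ` {..<N}. representation (e ` {..<N}) v w *\<^sub>R w)"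
    using sum_representation_eq[of "e ` {..<N}" v "e ` {..<N}"] e by simp
  then show ?thesis
    by (simp add: sum.reindex[OF e(1)] coord_def)
qed

lemma sorted_list_of_strict_mono_image:
  fixes r :: "nat \<Rightarrow> nat"
  assumes "strict_mono_on {..<k} r"
  shows "sorted_list_of_set (r ` {..<k}) = map r [0..<k]"
proof (rule sorted_distinct_set_unique)
  show "sorted (map r [0..<k])"
    unfolding sorted_iff_nth_mono_less using strict_mono_onD[OF assms] by (simp add: less_imp_le)
qed (auto simp: distinct_map atLeast0LessThan intro: strict_mono_on_imp_inj_on[OF assms])

lemma ex_strict_mono_enumeration:
  fixes I :: "nat set"
  assumes "I \<subseteq> {..<N}" "card I = k"
  obtains r where "strict_mono_on {..<k} r" "r ` {..<k} = I"
proof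
  have fin: "finite I"
    using assms(1) finite_subset by blast
  show "strict_mono_on {..<k} ((!) (sorted_list_of_set I))"
    using assms(2) sorted_wrt_nth_less[OF sorted_list_of_set.strict_sorted_key_list_of_set]
    by (intro strict_mono_onI) auto
  show "(!) (sorted_list_of_set I) ` {..<k} = I"
    using nth_image[of k "sorted_list_of_set I"] fin assms(2) by (simp add: lessThan_atLeast0)
qed

text \<open>
  The functional attached to \<open>I\<close> is the minor in the coordinates from \<open>I\<close>. On \<open>e\<^sub>J\<close> it is the
  determinant of an identity matrix if \<open>I = J\<close>; otherwise some element of \<open>I\<close> is not in \<open>J\<close> and gives
  a zero row.
\<close>

lemma pluecker_coordinate:
  fixes e :: "nat \<Rightarrow> 'v::real_vector"
  assumes e: "ordered_basis N e"
    and r: "strict_mono_on {..<k} r" "r ` {..<k} \<subseteq> {..<N}"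
  shows "representation (wedge_basis e ` {I. I \<subseteq> {..<N} \<and> card I = k})
      (c *\<^sub>R wedge (map b [0..<k])) (wedge_basis e (r ` {..<k}))
    = c * fdet k (\<lambda>i j. coord N e (r i) (b j))"
proof -
  define K where "K = {I. I \<subseteq> {..<N} \<and> card I = k}"
  have "\<exists>\<phi> :: 'v exterior \<Rightarrow> real. linear \<phi> \<and>
      (\<forall>b. \<phi> (wedge (map b [0..<k])) = fdet k (\<lambda>i j. coord N e (sorted_list_of_set I ! i) (b j)))" for I
    by (rule determinant_functional) (rule linear_coord[OF e])
  then obtain \<phi> :: "nat set \<Rightarrow> 'v exterior \<Rightarrow> real" where \<phi>: "\<And>I. linear (\<phi> I)"
      "\<And>I b. \<phi> I (wedge (map b [0..<k])) = fdet k (\<lambda>i j. coord N e (sorted_list_of_set I ! i) (b j))"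
    by metis
  have dual: "\<phi> I (wedge_basis e J) = (if I = J then 1 else 0)" if IJ: "I \<in> K" "J \<in> K" for I J
  proof -
    obtain p where p: "strict_mono_on {..<k} p" "p ` {..<k} = I"
      using IJ ex_strict_mono_enumeration[of I N k] by (auto simp: K_def)
    obtain q where q: "strict_mono_on {..<k} q" "q ` {..<k} = J"
      using IJ ex_strict_mono_enumeration[of J N k] by (auto simp: K_def)
    have bound: "p i < N" "q i < N" if "i < k" for i
      using that p(2) q(2) IJ by (auto simp: K_def)
    have "wedge_basis e J = wedge (map (\<lambda>j. e (q j)) [0..<k])"
      unfolding wedge_basis_def q(2)[symmetric] sorted_list_of_strict_mono_image[OF q(1)] by (simp add: o_def)
    then have "\<phi> I (wedge_basis e J) = fdet k (\<lambda>i j. coord N e (sorted_list_of_set I ! i) (e (q j)))"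
      by (simp add: \<phi>(2))
    also have "\<dots> = fdet k (\<lambda>i j. if p i = q j then 1 else 0)"
      using bound unfolding p(2)[symmetric] sorted_list_of_strict_mono_image[OF p(1)]
      by (intro fdet_cong) (simp add: coord_basis[OF e])
    also have "\<dots> = (if I = J then 1 else 0)"
    proof (cases "I = J")
      case True
      then have "p i = q i" if "i < k" for i
        using that pick_image_strict_mono_on p q by metis
      then have "fdet k (\<lambda>i j. if p i = q j then 1 else 0) = fdet k (\<lambda>i j. if i = j then 1 else 0)"
        using strict_mono_on_imp_inj_on[OF q(1)] by (intro fdet_cong) (auto simp: inj_on_eq_iff)
      also have "\<dots> = 1"
        by (subst fdet_lower_triangular) auto
      finally show ?thesis
        using True by simp
    next
      case False
      then obtain x where "x \<in> I" "x \<notin> J"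
        using IJ card_subset_eq[of J I] finite_subset[of J "{..<N}"] by (auto simp: K_def)
      then obtain i where "i < k" "p i \<notin> J"
        using p(2) by auto
      then have "fdet k (\<lambda>i j. if p i = q j then 1 else 0) = 0"
        using q(2) by (intro fdet_zero_row[of i]) auto
      then show ?thesis
        using False by simp
    qed
    finally show ?thesis .
  qed
  have "set (map b [0..<k]) \<subseteq> span (e ` {..<N})"
    using e by (simp add: ordered_basis_def)
  then have "c *\<^sub>R wedge (map b [0..<k]) \<in> span (wedge_basis e ` K)"
    unfolding K_def by (intro span_scale wedge_in_span) auto
  moreover have "r ` {..<k} \<in> K"
    using r by (simp add: K_def card_image strict_mono_on_imp_inj_on)
  moreover have "finite K"
    by (rule finite_subset[of _ "Pow {..<N}"]) (auto simp: K_def)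
  ultimately have "representation (wedge_basis e ` K) (c *\<^sub>R wedge (map b [0..<k])) (wedge_basis e (r ` {..<k}))
      = \<phi> (r ` {..<k}) (c *\<^sub>R wedge (map b [0..<k]))"
    using dual \<phi>(1) by (intro dual_functionals)
  also have "\<dots> = c * fdet k (\<lambda>i j. coord N e (sorted_list_of_set (r ` {..<k}) ! i) (b j))"
    by (simp add: linear_cmul[OF \<phi>(1)] \<phi>(2))
  also have "fdet k (\<lambda>i j. coord N e (sorted_list_of_set (r ` {..<k}) ! i) (b j))
      = fdet k (\<lambda>i j. coord N e (r i) (b j))"
    unfolding sorted_list_of_strict_mono_image[OF r(1)] by (intro fdet_cong) simp
  finally show ?thesis
    unfolding K_def .
qed

section \<open>Subspaces whose minors have one sign\<close>

text \<open>
  For small \<open>t > 0\<close> the sign of a polynomial is that of its lowest coefficient.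
\<close>

lemma eventually_polynomial_pos:
  fixes a :: "nat \<Rightarrow> real"
  assumes "i0 < N" "a i0 > 0" "\<And>i. i < i0 \<Longrightarrow> a i = 0"
  shows "\<forall>\<^sub>F t in at_right 0. (\<Sum>i<N. a i * t ^ i) > 0"
proof -
  define g where "g t = (\<Sum>i<N - i0. a (i0 + i) * t ^ i)" for t
  have eq: "(\<Sum>i<N. a i * t ^ i) = t ^ i0 * g t" for t
  proof -
    have "(\<Sum>i<N. a i * t ^ i) = (\<Sum>i\<in>{i0..<N}. a i * t ^ i)"
      using assms(3) by (intro sum.mono_neutral_right) auto
    also have "\<dots> = (\<Sum>i\<in>{0..<N - i0}. a (i + i0) * t ^ (i + i0))"
      using sum.shift_bounds_nat_ivl[of "\<lambda>i. a i * t ^ i" 0 i0 "N - i0"] assms(1) by simp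
    finally show ?thesis
      by (simp add: g_def sum_distrib_left power_add ac_simps lessThan_atLeast0)
  qed
  have "isCont g 0"
    unfolding g_def by (intro continuous_intros)
  then have "(g \<longlongrightarrow> g 0) (at_right 0)"
    by (meson at_le filterlim_at_split isCont_def tendsto_within_subset subset_UNIV)
  moreover have "g 0 = a i0"
    using assms(1) by (cases "N - i0") (auto simp: g_def sum.lessThan_Suc_shift simp del: sum.lessThan_Suc)
  ultimately have "\<forall>\<^sub>F t in at_right 0. g t > 0"
    using assms(2) by (intro order_tendstoD) auto
  moreover have "\<forall>\<^sub>F t in at_right 0. (t::real) > 0"
    by (simp add: eventually_at_right_less)
  ultimately show ?thesis
    by eventually_elim (simp add: eq)
qed

lemma fdet_column_expansion:
  assumes "q < n"
  shows "\<exists>C. \<forall>y. fdet n (\<lambda>i j. if j = q then y i else A i j) = (\<Sum>i<n. C i * y i)"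
proof -
  obtain C where C: "\<And>y. fdet n ((\<lambda>j i. A i j)(q := y)) = (\<Sum>i<n. C i * y i)"
    using fdet_row_expansion[OF assms] by blast
  have "fdet n (\<lambda>i j. if j = q then y i else A i j) = fdet n ((\<lambda>j i. A i j)(q := y))" for y
    by (subst fdet_transpose[symmetric]) (intro fdet_cong, simp)
  then show ?thesis
    using C by auto
qed

lemma fdet_last_column_unit:
  assumes "\<And>i. i \<le> n \<Longrightarrow> A i n = (if i = n then 1 else 0)"
  shows "fdet (Suc n) A = fdet n A"
proof -
  have "fdet (Suc n) A = Determinant.det (four_block_mat (mat n n (\<lambda>(i, j). A i j)) (0\<^sub>m n 1)
      (mat 1 n (\<lambda>(i, j). A n j)) (1\<^sub>m 1))"
    unfolding fdet_def using assms
    by (intro arg_cong[of _ _ Determinant.det] eq_matI) (auto simp: less_Suc_eq not_less le_Suc_eq)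
  also have "\<dots> = fdet n A * 1"
    unfolding fdet_def by (subst det_four_block_mat_upper_right_zero[of _ n _ 1]) auto
  finally show ?thesis
    by simp
qed

text \<open>
  All Pluecker coordinates of \<open>b 0, \<dots>, b (m - 1)\<close> are nonzero and have one sign. Allowing both
  signs makes this independent of the basis chosen in a subspace.
\<close>

definition same_sign_minors :: "nat \<Rightarrow> (nat \<Rightarrow> 'v::real_vector) \<Rightarrow> nat \<Rightarrow> (nat \<Rightarrow> 'v) \<Rightarrow> bool" where
  "same_sign_minors N e m b \<longleftrightarrow> (\<exists>\<sigma>. \<forall>r. strict_mono_on {..<m} r \<longrightarrow> r ` {..<m} \<subseteq> {..<N} \<longrightarrow>
     \<sigma> * fdet m (\<lambda>i j. coord N e (r i) (b j)) > 0)"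

lemma same_sign_minors_span:
  assumes e: "ordered_basis N e" and c: "same_sign_minors N e m c"
    and "\<And>j. j < m \<Longrightarrow> c j \<in> span (b ` {..<m})"
  shows "same_sign_minors N e m b"
proof -
  obtain s where s: "\<And>f. (\<And>a. a < m \<Longrightarrow> linear (f a)) \<Longrightarrow>
      fdet m (\<lambda>a i. f a (c i)) = s * fdet m (\<lambda>a i. f a (b i))"
    using minors_proportional[of m c b] assms(3) by blast
  obtain \<sigma> where "\<And>r. strict_mono_on {..<m} r \<Longrightarrow> r ` {..<m} \<subseteq> {..<N} \<Longrightarrow>
      \<sigma> * fdet m (\<lambda>i j. coord N e (r i) (c j)) > 0"
    using c by (auto simp: same_sign_minors_def)
  then show ?thesis
    unfolding same_sign_minors_def using s[OF linear_coord[OF e]]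
    by (intro exI[of _ "\<sigma> * s"]) (simp add: mult.assoc)
qed

text \<open>
  Only the values of \<open>r\<close> below \<open>m\<close> matter, so there are finitely many conditions on \<open>t\<close>.
\<close>

lemma eventually_all_strict_mono:
  fixes P :: "(nat \<Rightarrow> nat) \<Rightarrow> real \<Rightarrow> bool"
  assumes cong: "\<And>r r' t. (\<And>i. i < m \<Longrightarrow> r i = r' i) \<Longrightarrow> P r t \<Longrightarrow> P r' t"
    and ev: "\<And>r. strict_mono_on {..<m} r \<Longrightarrow> r ` {..<m} \<subseteq> {..<N} \<Longrightarrow> \<forall>\<^sub>F t in at_right 0. P r t"
  shows "\<forall>\<^sub>F t in at_right 0. \<forall>r. strict_mono_on {..<m} r \<longrightarrow> r ` {..<m} \<subseteq> {..<N} \<longrightarrow> P r t"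
proof -
  let ?R = "{r \<in> {..<m} \<rightarrow>\<^sub>E {..<N}. strict_mono_on {..<m} r}"
  have "finite ?R"
    by (rule finite_subset[OF _ finite_PiE[of "{..<m}" "\<lambda>_. {..<N}"]]) auto
  then have "\<forall>\<^sub>F t in at_right 0. \<forall>r\<in>?R. P r t"
    using ev by (intro eventually_ball_finite) (auto simp: PiE_iff image_subset_iff)
  then show ?thesis
  proof eventually_elim
    case (elim t)
    show ?case
    proof (intro allI impI)
      fix r assume r: "strict_mono_on {..<m} r" "r ` {..<m} \<subseteq> {..<N}"
      have "strict_mono_on {..<m} (restrict r {..<m})"
        using strict_mono_onD[OF r(1)] by (auto intro!: strict_mono_onI)
      then have "restrict r {..<m} \<in> ?R"
        using r(2) by auto
      then have "P (restrict r {..<m}) t"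
        using elim by blast
      then show "P r t"
        by (rule cong[rotated]) simp
    qed
  qed
qed

text \<open>
  The new vector is \<open>\<Sum> t\<^sup>N\<^sup>-\<^sup>1\<^sup>-\<^sup>i e\<^sub>i\<close>. Expanded along its column, the minor in the rows \<open>r 0 < \<dots> < r m\<close>
  is a polynomial in \<open>t\<close> whose lowest term comes from the largest row \<open>r m\<close>. Its coefficient is the
  old minor in the rows \<open>r 0, \<dots>, r (m - 1)\<close>.
\<close>

lemma same_sign_minors_extend:
  fixes e :: "nat \<Rightarrow> 'v::real_vector"
  assumes e: "ordered_basis N e" and b: "same_sign_minors N e m b"
  obtains v where "same_sign_minors N e (Suc m) (b(m := v))"
proof -
  obtain \<sigma> where \<sigma>: "\<And>r. strict_mono_on {..<m} r \<Longrightarrow> r ` {..<m} \<subseteq> {..<N} \<Longrightarrow>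
      \<sigma> * fdet m (\<lambda>i j. coord N e (r i) (b j)) > 0"
    using b by (auto simp: same_sign_minors_def)
  define v where "v t = (\<Sum>i<N. t ^ (N - Suc i) *\<^sub>R e i)" for t :: real
  let ?P = "\<lambda>r t. \<sigma> * fdet (Suc m) (\<lambda>i j. coord N e (r i) ((b(m := v t)) j)) > 0"
  have "\<forall>\<^sub>F t in at_right 0. ?P r t" if r: "strict_mono_on {..<Suc m} r" "r ` {..<Suc m} \<subseteq> {..<N}" for r
  proof -
    define D where "D y = fdet (Suc m) (\<lambda>i j. if j = m then y i else coord N e (r i) (b j))" for y
    obtain C where C: "\<And>y. D y = (\<Sum>i<Suc m. C i * y i)"
      using fdet_column_expansion[of m "Suc m" "\<lambda>i j. coord N e (r i) (b j)"] unfolding D_def by auto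
    have rN: "r i < N" if "i \<le> m" for i
      using image_subset_iff[of r "{..<Suc m}"] r(2) that by simp
    have rless: "r i < r m" if "i < m" for i
      using strict_mono_onD[OF r(1)] that by simp
    define a where "a l = D (\<lambda>i. if r i = N - Suc l then 1 else 0)" for l
    have "fdet (Suc m) (\<lambda>i j. coord N e (r i) ((b(m := v t)) j)) = (\<Sum>l<N. a l * t ^ l)" for t
    proof -
      have coord_v: "coord N e l (v t) = t ^ (N - Suc l)" if "l < N" for l
      proof -
        have "coord N e l (v t) = (\<Sum>i<N. t ^ (N - Suc i) * (if l = i then 1 else 0))"
          unfolding v_def using that
          by (simp add: linear_sum[OF linear_coord[OF e]] linear_cmul[OF linear_coord[OF e]] coord_basis[OF e])
        also have "\<dots> = (\<Sum>i<N. if l = i then t ^ (N - Suc i) else 0)"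
          by (intro sum.cong) auto
        finally show ?thesis
          using that by simp
      qed
      have "fdet (Suc m) (\<lambda>i j. coord N e (r i) ((b(m := v t)) j)) = D (\<lambda>i. t ^ (N - Suc (r i)))"
        unfolding D_def using coord_v rN by (intro fdet_cong) auto
      also have "\<dots> = (\<Sum>i<Suc m. \<Sum>l<N. if r i = N - Suc l then C i * t ^ l else 0)"
        unfolding C
      proof (intro sum.cong refl)
        fix i assume "i \<in> {..<Suc m}"
        then have "r i < N"
          using rN by simp
        then have "(\<Sum>l<N. if r i = N - Suc l then C i * t ^ l else 0)
            = (\<Sum>l<N. if l = N - Suc (r i) then C i * t ^ l else 0)"
          by (intro sum.cong) auto
        then show "C i * t ^ (N - Suc (r i)) = (\<Sum>l<N. if r i = N - Suc l then C i * t ^ l else 0)"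
          using \<open>r i < N\<close> by simp
      qed
      also have "\<dots> = (\<Sum>l<N. \<Sum>i<Suc m. if r i = N - Suc l then C i * t ^ l else 0)"
        by (rule sum.swap)
      also have "\<dots> = (\<Sum>l<N. a l * t ^ l)"
        unfolding a_def C sum_distrib_right by (intro sum.cong) auto
      finally show ?thesis .
    qed
    moreover have "\<forall>\<^sub>F t in at_right 0. (\<Sum>l<N. (\<sigma> * a l) * t ^ l) > 0"
    proof (rule eventually_polynomial_pos)
      show "N - Suc (r m) < N"
        using rN[of m] by simp
      have "a (N - Suc (r m)) = D (\<lambda>i. if i = m then 1 else 0)"
        unfolding a_def C using rless rN by (intro sum.cong) (force simp: less_Suc_eq)+
      also have "\<dots> = fdet m (\<lambda>i j. coord N e (r i) (b j))"
        unfolding D_def by (subst fdet_last_column_unit) (auto intro!: fdet_cong)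
      finally have "a (N - Suc (r m)) = fdet m (\<lambda>i j. coord N e (r i) (b j))" .
      moreover have "strict_mono_on {..<m} r" "r ` {..<m} \<subseteq> {..<N}"
        using strict_mono_onD[OF r(1)] rN by (auto intro!: strict_mono_onI)
      ultimately show "\<sigma> * a (N - Suc (r m)) > 0"
        using \<sigma> by simp
      show "\<sigma> * a l = 0" if "l < N - Suc (r m)" for l
      proof -
        have "r i \<noteq> N - Suc l" if "i < Suc m" for i
          using rless[of i] \<open>l < N - Suc (r m)\<close> that by (cases "i = m") auto
        then show ?thesis
          by (simp add: a_def C)
      qed
    qed
    ultimately show ?thesis
      by (simp add: sum_distrib_left mult.assoc)
  qed
  then have ev: "\<forall>\<^sub>F t in at_right 0. \<forall>r. strict_mono_on {..<Suc m} r \<longrightarrow> r ` {..<Suc m} \<subseteq> {..<N} \<longrightarrow> ?P r t"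
  proof (intro eventually_all_strict_mono)
    fix r r' :: "nat \<Rightarrow> nat" and t
    assume "\<And>i. i < Suc m \<Longrightarrow> r i = r' i" "?P r t"
    then show "?P r' t"
      using fdet_cong[of "Suc m" "\<lambda>i j. coord N e (r i) ((b(m := v t)) j)" "\<lambda>i j. coord N e (r' i) ((b(m := v t)) j)"]
      by simp
  qed
  obtain t where "\<forall>r. strict_mono_on {..<Suc m} r \<longrightarrow> r ` {..<Suc m} \<subseteq> {..<N} \<longrightarrow> ?P r t"
    using eventually_happens'[OF trivial_limit_at_right_real ev] by blast
  then show ?thesis
    using that[of "v t"] by (auto simp: same_sign_minors_def)
qed

lemma same_sign_minors_cong:
  assumes "\<And>j. j < m \<Longrightarrow> b j = c j"
  shows "same_sign_minors N e m b = same_sign_minors N e m c"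
proof -
  have "fdet m (\<lambda>i j. coord N e (r i) (b j)) = fdet m (\<lambda>i j. coord N e (r i) (c j))" for r
    using assms by (intro fdet_cong) simp
  then show ?thesis
    by (simp add: same_sign_minors_def)
qed

text \<open>
  Let \<open>\<lambda> = \<Sum> (- t)\<^sup>l x\<^sub>l\<close>, where \<open>x\<^sub>l\<close> are the coordinates. The minor of \<open>ker \<lambda>\<close> within the subspace in the rows \<open>r\<close> is,
  up to a factor independent of \<open>r\<close>, the determinant in the linear forms \<open>\<lambda>, x\<^sub>r\<^sub>0, x\<^sub>r\<^sub>1, \<dots>\<close>. As a
  polynomial in \<open>t\<close>, this has a lowest term of degree \<open>i0\<close>, the least index that is not among the
  \<open>r i\<close>. Moving \<open>x\<^sub>i\<^sub>0\<close> behind the \<open>i0\<close> smaller rows costs the sign \<open>(- 1)\<^sup>i\<^sup>0\<close>, which cancels the sign in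
  \<open>\<lambda>\<close> and leaves a minor of the given subspace. A basis adapted to \<open>ker \<lambda>\<close> arises by subtracting
  multiples of \<open>c m\<close>, provided that \<open>\<lambda> (c m)\<close> does not vanish; this too holds for small \<open>t\<close>.
\<close>

lemma same_sign_minors_restrict:
  fixes e :: "nat \<Rightarrow> 'v::real_vector"
  assumes e: "ordered_basis N e" and c: "same_sign_minors N e (Suc m) c" and mN: "Suc m \<le> N"
  shows "\<exists>b. span (b ` {..<Suc m}) = span (c ` {..<Suc m}) \<and> same_sign_minors N e m b"
proof -
  obtain \<sigma> where \<sigma>: "\<And>r. strict_mono_on {..<Suc m} r \<Longrightarrow> r ` {..<Suc m} \<subseteq> {..<N} \<Longrightarrow>
      \<sigma> * fdet (Suc m) (\<lambda>i j. coord N e (r i) (c j)) > 0"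
    using c by (auto simp: same_sign_minors_def)
  define lam where "lam t v = (\<Sum>l<N. ((-1) ^ l * coord N e l v) * t ^ l)" for t :: real and v
  have lam: "linear (lam t)" for t
    unfolding lam_def
    by (intro linearI)
      (simp_all add: linear_add[OF linear_coord[OF e]] linear_cmul[OF linear_coord[OF e]]
        algebra_simps sum.distrib sum_distrib_left)
  define row where "row r t i = (if i = 0 then lam t else coord N e (r (i - 1)))" for r t and i :: nat
  let ?P = "\<lambda>r t. \<sigma> * fdet (Suc m) (\<lambda>i j. row r t i (c j)) > 0"
  have "\<forall>\<^sub>F t in at_right 0. ?P r t" if r: "strict_mono_on {..<m} r" "r ` {..<m} \<subseteq> {..<N}" for r
  proof -
    define D where "D y = fdet (Suc m) ((\<lambda>i j. coord N e (r (i - 1)) (c j))(0 := y))" for y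
    obtain C where C: "\<And>y. D y = (\<Sum>j<Suc m. C j * y j)"
      using fdet_row_expansion[of 0 "Suc m" "\<lambda>i j. coord N e (r (i - 1)) (c j)"] unfolding D_def by auto
    have rN: "r i < N" if "i < m" for i
      using r(2) that by auto
    \<comment> \<open>The least index that is not a value of the increasing sequence \<open>r 0, \<dots>, r (m - 1)\<close>.\<close>
    define i0 where "i0 = (LEAST i. i = m \<or> r i \<noteq> i)"
    have i0: "i0 = m \<or> r i0 \<noteq> i0"
      unfolding i0_def by (rule LeastI[of _ m]) simp
    have i0m: "i0 \<le> m"
      unfolding i0_def by (rule Least_le) simp
    have fixed: "r i = i" if "i < i0" for i
      using not_less_Least[of i "\<lambda>i. i = m \<or> r i \<noteq> i"] that by (simp add: i0_def)
    have above: "i0 < r i" if "i0 \<le> i" "i < m" for i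
    proof -
      have "0 + i0 \<le> r 0 + i0" "r 0 + i0 \<le> r i0" "r i0 + (i - i0) \<le> r i"
        using strict_mono_on_add_le[OF r(1), of 0 i0] strict_mono_on_add_le[OF r(1), of i0 "i - i0"] that
        by simp_all
      then show ?thesis
        using i0 that by linarith
    qed
    define r' where "r' i = (if i < i0 then i else if i = i0 then i0 else r (i - 1))" for i
    have r': "strict_mono_on {..<Suc m} r'"
    proof (rule strict_mono_onI)
      fix i j assume ij: "i \<in> {..<Suc m}" "j \<in> {..<Suc m}" "i < j"
      have "i0 < r (j - 1)" if "i0 < j"
        using above[of "j - 1"] ij that by simp
      moreover have "r (i - 1) < r (j - 1)" if "i0 < i"
        using strict_mono_onD[OF r(1), of "i - 1" "j - 1"] ij that by simp
      ultimately show "r' i < r' j"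
        using ij by (simp add: r'_def) linarith
    qed
    have r'N: "r' ` {..<Suc m} \<subseteq> {..<N}"
      using rN i0m mN by (auto simp: r'_def)
    define a where "a l = \<sigma> * ((-1) ^ l * D (\<lambda>j. coord N e l (c j)))" for l
    have "\<sigma> * fdet (Suc m) (\<lambda>i j. row r t i (c j)) = (\<Sum>l<N. a l * t ^ l)" for t
    proof -
      have "fdet (Suc m) (\<lambda>i j. row r t i (c j)) = D (\<lambda>j. lam t (c j))"
        unfolding D_def row_def by (intro fdet_cong) simp
      also have "\<dots> = (\<Sum>j<Suc m. \<Sum>l<N. C j * ((-1) ^ l * coord N e l (c j) * t ^ l))"
        unfolding C lam_def sum_distrib_left by simp
      also have "\<dots> = (\<Sum>l<N. \<Sum>j<Suc m. C j * ((-1) ^ l * coord N e l (c j) * t ^ l))"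
        by (rule sum.swap)
      finally show ?thesis
        unfolding a_def C by (simp only: sum_distrib_left sum_distrib_right ac_simps)
    qed
    moreover have "\<forall>\<^sub>F t in at_right 0. (\<Sum>l<N. a l * t ^ l) > 0"
    proof (rule eventually_polynomial_pos)
      show "i0 < N"
        using i0m mN by simp
      have "D (\<lambda>j. coord N e i0 (c j)) = fdet (Suc m) (\<lambda>i. if i = 0 then (\<lambda>i j. coord N e (r' i) (c j)) i0
          else if i \<le> i0 then (\<lambda>i j. coord N e (r' i) (c j)) (i - 1) else (\<lambda>i j. coord N e (r' i) (c j)) i)"
        unfolding D_def using fixed by (intro fdet_cong) (auto simp: r'_def)
      also have "\<dots> = (-1) ^ i0 * fdet (Suc m) (\<lambda>i j. coord N e (r' i) (c j))"
        using i0m by (intro fdet_move_row) simp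
      finally have "a i0 = ((-1) ^ i0 * (-1) ^ i0) * (\<sigma> * fdet (Suc m) (\<lambda>i j. coord N e (r' i) (c j)))"
        by (simp only: a_def ac_simps)
      also have "(-1) ^ i0 * (-1) ^ i0 = (1 :: real)"
        by (simp flip: power_mult_distrib)
      finally show "a i0 > 0"
        using \<sigma>[OF r' r'N] by simp
      show "a l = 0" if "l < i0" for l
      proof -
        have "D (\<lambda>j. coord N e l (c j)) = 0"
          unfolding D_def using that i0m fixed by (intro fdet_equal_rows[of 0 _ "Suc l"]) auto
        then show ?thesis
          by (simp add: a_def)
      qed
    qed
    ultimately show ?thesis
      by simp
  qed
  then have ev1: "\<forall>\<^sub>F t in at_right 0. \<forall>r. strict_mono_on {..<m} r \<longrightarrow> r ` {..<m} \<subseteq> {..<N} \<longrightarrow> ?P r t"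
  proof (intro eventually_all_strict_mono)
    fix r r' :: "nat \<Rightarrow> nat" and t
    assume "\<And>i. i < m \<Longrightarrow> r i = r' i" "?P r t"
    moreover from this(1) have "fdet (Suc m) (\<lambda>i j. row r t i (c j)) = fdet (Suc m) (\<lambda>i j. row r' t i (c j))"
      by (intro fdet_cong) (auto simp: row_def)
    ultimately show "?P r' t"
      by simp
  qed
  have ev2: "\<forall>\<^sub>F t in at_right 0. lam t (c m) \<noteq> 0"
  proof -
    have ex: "\<exists>l<N. coord N e l (c m) \<noteq> 0"
    proof (rule ccontr)
      assume "\<not> ?thesis"
      then have "fdet (Suc m) (\<lambda>j i. coord N e i (c j)) = 0"
        using mN by (intro fdet_zero_row[of m]) auto
      moreover have "\<sigma> * fdet (Suc m) (\<lambda>i j. coord N e i (c j)) > 0"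
        using mN by (intro \<sigma>) (auto intro!: strict_mono_onI)
      ultimately show False
        using fdet_transpose[of "Suc m" "\<lambda>i j. coord N e i (c j)"] by simp
    qed
    define i0 where "i0 = (LEAST l. l < N \<and> coord N e l (c m) \<noteq> 0)"
    have i0: "i0 < N" "coord N e i0 (c m) \<noteq> 0"
      using LeastI_ex[OF ex] by (simp_all add: i0_def)
    have below: "coord N e l (c m) = 0" if "l < i0" for l
      using not_less_Least[of l "\<lambda>l. l < N \<and> coord N e l (c m) \<noteq> 0"] that i0(1) by (simp add: i0_def)
    \<comment> \<open>Multiplying by the lowest coefficient makes it positive, whatever its sign.\<close>
    define \<kappa> where "\<kappa> = (-1) ^ i0 * coord N e i0 (c m)"
    have "\<forall>\<^sub>F t in at_right 0. (\<Sum>l<N. (\<kappa> * ((-1) ^ l * coord N e l (c m))) * t ^ l) > 0"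
    proof (rule eventually_polynomial_pos[OF i0(1)])
      have "\<kappa> \<noteq> 0"
        using i0(2) by (simp add: \<kappa>_def)
      then show "\<kappa> * ((-1) ^ i0 * coord N e i0 (c m)) > 0"
        unfolding \<kappa>_def[symmetric] using not_real_square_gt_zero by blast
    qed (simp add: below)
    then show ?thesis
    proof eventually_elim
      case (elim t)
      then have "\<kappa> * lam t (c m) > 0"
        by (simp add: lam_def sum_distrib_left mult.assoc)
      then show ?case
        by auto
    qed
  qed
  obtain t where t: "\<And>r. strict_mono_on {..<m} r \<Longrightarrow> r ` {..<m} \<subseteq> {..<N} \<Longrightarrow> ?P r t"
      and nz: "lam t (c m) \<noteq> 0"
    using eventually_happens'[OF trivial_limit_at_right_real eventually_conj[OF ev1 ev2]] by blast
  define q where "q j = lam t (c j) / lam t (c m)" for j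
  define b where "b j = (if j < m then c j - q j *\<^sub>R c m else c j)" for j
  have b_in: "b j \<in> span (c ` {..<Suc m})" if "j < Suc m" for j
  proof -
    have c: "c i \<in> span (c ` {..<Suc m})" if "i < Suc m" for i
      using that by (intro span_base) auto
    show ?thesis
      using c[OF that] c[of m] by (simp add: b_def span_diff span_scale)
  qed
  have c_in: "c j \<in> span (b ` {..<Suc m})" if "j < Suc m" for j
  proof -
    have "b j + (if j < m then q j else 0) *\<^sub>R b m \<in> span (b ` {..<Suc m})"
      using that by (intro span_add span_scale span_base) auto
    then show ?thesis
      by (simp add: b_def split: if_splits)
  qed
  have "span (b ` {..<Suc m}) = span (c ` {..<Suc m})"
    using b_in c_in by (subst span_eq) blast
  moreover have "same_sign_minors N e m b"
  proof -
    obtain s where s: "\<And>f. (\<And>a. a < Suc m \<Longrightarrow> linear (f a)) \<Longrightarrow>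
        fdet (Suc m) (\<lambda>a i. f a (c i)) = s * fdet (Suc m) (\<lambda>a i. f a (b i))"
      using minors_proportional[of "Suc m" c b] c_in by blast
    have "\<sigma> * s * ((-1) ^ m * lam t (c m)) * fdet m (\<lambda>i j. coord N e (r i) (b j)) > 0"
      if r: "strict_mono_on {..<m} r" "r ` {..<m} \<subseteq> {..<N}" for r
    proof -
      have "lam t (b j) = 0" if "j < m" for j
        using that nz by (simp add: b_def linear_diff[OF lam] linear_cmul[OF lam] q_def)
      then have "fdet (Suc m) (\<lambda>i j. row r t i (b j))
          = (-1) ^ m * lam t (c m) * fdet m (\<lambda>i j. row r t (Suc i) (b (insert_index m j)))"
        by (subst fdet_first_row_single[of m]) (auto simp: row_def b_def)
      also have "fdet m (\<lambda>i j. row r t (Suc i) (b (insert_index m j))) = fdet m (\<lambda>i j. coord N e (r i) (b j))"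
        by (intro fdet_cong) (simp add: row_def)
      finally have "fdet (Suc m) (\<lambda>i j. row r t i (c j))
          = s * ((-1) ^ m * lam t (c m) * fdet m (\<lambda>i j. coord N e (r i) (b j)))"
        using s[of "row r t"] lam linear_coord[OF e] by (simp add: row_def)
      then show ?thesis
        using t[OF r] by (simp add: mult.assoc)
    qed
    then show ?thesis
      unfolding same_sign_minors_def by blast
  qed
  ultimately show ?thesis
    by blast
qed

lemma same_sign_flag_below:
  fixes e :: "nat \<Rightarrow> 'v::real_vector"
  assumes e: "ordered_basis N e"
  shows "same_sign_minors N e m c \<Longrightarrow> m \<le> N \<Longrightarrow>
    \<exists>b. span (b ` {..<m}) = span (c ` {..<m}) \<and> (\<forall>j\<le>m. same_sign_minors N e j b)"
proof (induction m arbitrary: c)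
  case 0
  then show ?case
    by auto
next
  case (Suc m)
  obtain b where b: "span (b ` {..<Suc m}) = span (c ` {..<Suc m})" "same_sign_minors N e m b"
    using same_sign_minors_restrict[OF e Suc.prems] by blast
  then obtain d where d: "span (d ` {..<m}) = span (b ` {..<m})" "\<And>j. j \<le> m \<Longrightarrow> same_sign_minors N e j d"
    using Suc.IH[of b] Suc.prems by auto
  define d' where "d' = d(m := b m)"
  have image: "d' ` {..<Suc m} = insert (b m) (d ` {..<m})" "b ` {..<Suc m} = insert (b m) (b ` {..<m})"
    by (auto simp: d'_def lessThan_Suc)
  have span: "span (d' ` {..<Suc m}) = span (c ` {..<Suc m})"
    unfolding b(1)[symmetric] image using d(1) by (simp add: span_insert)
  have "same_sign_minors N e (Suc m) d'"
    by (rule same_sign_minors_span[OF e Suc.prems(1)]) (simp add: span span_base)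
  moreover have "same_sign_minors N e j d'" if "j \<le> m" for j
    using d(2)[OF that] that by (subst same_sign_minors_cong[of j d' d]) (auto simp: d'_def)
  ultimately show ?case
    using span by (auto simp: le_Suc_eq)
qed

lemma same_sign_flag_above:
  fixes e :: "nat \<Rightarrow> 'v::real_vector"
  assumes e: "ordered_basis N e" and b: "\<And>j. j \<le> m \<Longrightarrow> same_sign_minors N e j b"
  shows "\<exists>c. (\<forall>j<m. c j = b j) \<and> (\<forall>j\<le>m + d. same_sign_minors N e j c)"
proof (induction d)
  case 0
  then show ?case
    using b by auto
next
  case (Suc d)
  then obtain c where c: "\<And>j. j < m \<Longrightarrow> c j = b j" "\<And>j. j \<le> m + d \<Longrightarrow> same_sign_minors N e j c"
    by blast
  obtain v where v: "same_sign_minors N e (Suc (m + d)) (c(m + d := v))"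
    using same_sign_minors_extend[OF e c(2)[of "m + d"]] by blast
  have "same_sign_minors N e j (c(m + d := v))" if "j \<le> m + d" for j
    using c(2)[OF that] that by (subst same_sign_minors_cong[of j _ c]) auto
  then have "\<forall>j\<le>m + Suc d. same_sign_minors N e j (c(m + d := v))"
    using v by (simp add: le_Suc_eq del: fun_upd_apply)
  moreover have "\<forall>j<m. (c(m + d := v)) j = b j"
    using c(1) by simp
  ultimately show ?case
    by blast
qed

lemma independent_of_minor:
  fixes w :: "nat \<Rightarrow> 'v::real_vector" and f :: "nat \<Rightarrow> 'v \<Rightarrow> real"
  assumes f: "\<And>i. i < m \<Longrightarrow> linear (f i)" and nz: "fdet m (\<lambda>i j. f i (w j)) \<noteq> 0"
  shows "inj_on w {..<m}" "independent (w ` {..<m})"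
proof -
  show inj: "inj_on w {..<m}"
  proof (rule inj_onI, rule ccontr)
    fix i j assume "i \<in> {..<m}" "j \<in> {..<m}" "w i = w j" "i \<noteq> j"
    then have "fdet m (\<lambda>j i. f i (w j)) = 0"
      by (intro fdet_equal_rows[of i m j]) auto
    then show False
      using nz fdet_transpose[of m "\<lambda>i j. f i (w j)"] by simp
  qed
  show "independent (w ` {..<m})"
  proof (rule independent_if_scalars_zero)
    fix g v assume g: "(\<Sum>v\<in>w ` {..<m}. g v *\<^sub>R v) = 0" and "v \<in> w ` {..<m}"
    then obtain j where j: "j < m" "v = w j"
      by blast
    have "(\<Sum>j<m. f i (w j) * g (w j)) = 0" if "i < m" for i
    proof -
      have "(\<Sum>j<m. f i (w j) * g (w j)) = f i (\<Sum>v\<in>w ` {..<m}. g v *\<^sub>R v)"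
        by (simp add: sum.reindex[OF inj] linear_sum[OF f[OF that]] linear_cmul[OF f[OF that]] mult.commute)
      then show ?thesis
        unfolding g linear_0[OF f[OF that]] .
    qed
    from fdet_nonzero_kernel[OF nz this j(1)] show "g v = 0"
      using j(2) by simp
  qed simp
qed

text \<open>
  \<open>V\<close> is an arbitrary real vector space here, so the comparison of dimensions is an
  exchange argument.
\<close>

lemma span_eq_of_independent:
  fixes w c :: "nat \<Rightarrow> 'v::real_vector"
  assumes "inj_on w {..<m}" "independent (w ` {..<m})" "\<And>j. j < m \<Longrightarrow> w j \<in> span (c ` {..<m})"
  shows "span (w ` {..<m}) = span (c ` {..<m})"
proof -
  have w: "w ` {..<m} \<subseteq> span (c ` {..<m})"
    using assms(3) by auto
  have card: "card (w ` {..<m}) = m" "card (c ` {..<m}) \<le> m"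
    using card_image[OF assms(1)] card_image_le[of "{..<m}" c] by simp_all
  have "c j \<in> span (w ` {..<m})" if "j < m" for j
  proof (rule ccontr)
    assume nin: "c j \<notin> span (w ` {..<m})"
    then have "independent (insert (c j) (w ` {..<m}))"
      using assms(2) by (intro independent_insertI)
    moreover have "insert (c j) (w ` {..<m}) \<subseteq> span (c ` {..<m})"
      using w that by (auto intro: span_base)
    ultimately have "card (insert (c j) (w ` {..<m})) \<le> card (c ` {..<m})"
      using independent_span_bound[of "c ` {..<m}"] by blast
    then show False
      using card nin span_base[of "c j" "w ` {..<m}"] by (simp add: card_insert_if split: if_splits)
  qed
  then show ?thesis
    using w by (subst span_eq) blast
qed

text \<open>
  As the leading minor of size \<open>j + 1\<close> does not vanish, the span of \<open>c 0, \<dots>, c j\<close> contains a vector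
  \<open>w j\<close> whose first \<open>j + 1\<close> coordinates are \<open>0, \<dots>, 0, 1\<close>. The minors of \<open>w\<close> are proportional to those
  of \<open>c\<close>, hence of one sign, and the leading ones are \<open>1\<close>.
\<close>

lemma unipotent_basis:
  fixes e :: "nat \<Rightarrow> 'v::real_vector"
  assumes e: "ordered_basis N e" and c: "\<And>j. j \<le> N \<Longrightarrow> same_sign_minors N e j c"
  shows "\<exists>w. \<exists>u\<in>totally_positive_unipotent N.
    (\<forall>i<N. \<forall>j<N. u $$ (i, j) = coord N e i (w j)) \<and>
    (\<forall>m\<le>N. span (w ` {..<m}) = span (c ` {..<m}) \<and> dim (span (w ` {..<m})) = m)"
proof -
  have id: "strict_mono_on {..<m} (\<lambda>i :: nat. i)" "(\<lambda>i. i) ` {..<m} \<subseteq> {..<N}" if "m \<le> N" for m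
    using that by (auto intro!: strict_mono_onI)
  have "\<exists>v. v \<in> span (c ` {..<Suc j}) \<and> (\<forall>i\<le>j. coord N e i v = (if i = j then 1 else 0))" if "j < N" for j
  proof -
    have "fdet (Suc j) (\<lambda>i l. coord N e i (c l)) \<noteq> 0"
      using c[of "Suc j"] id[of "Suc j"] that unfolding same_sign_minors_def by fastforce
    then obtain t where t: "\<And>i. i < Suc j \<Longrightarrow> (\<Sum>l<Suc j. coord N e i (c l) * t l) = (if i = j then 1 else 0)"
      using fdet_nonzero_solvable[where b = "\<lambda>i. if i = j then 1 else 0"] by blast
    let ?v = "\<Sum>l<Suc j. t l *\<^sub>R c l"
    have "?v \<in> span (c ` {..<Suc j})"
      by (intro span_sum span_scale span_base) auto
    moreover have "coord N e i ?v = (if i = j then 1 else 0)" if "i \<le> j" for i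
      using t[of i] that
      by (simp only: linear_sum[OF linear_coord[OF e]] linear_cmul[OF linear_coord[OF e]]
          real_scaleR_def less_Suc_eq_le mult.commute)
    ultimately show ?thesis
      by blast
  qed
  then obtain w where w: "\<And>j. j < N \<Longrightarrow> w j \<in> span (c ` {..<Suc j})"
      "\<And>i j. j < N \<Longrightarrow> i \<le> j \<Longrightarrow> coord N e i (w j) = (if i = j then 1 else 0)"
    by metis
  have w_span: "w j \<in> span (c ` {..<m})" if "j < m" "m \<le> N" for j m
    by (rule subsetD[OF span_mono[OF image_mono] w(1)]) (use that in auto)
  have leading: "fdet m (\<lambda>i j. coord N e i (w j)) = 1" if "m \<le> N" for m
    using that w(2) by (subst fdet_lower_triangular) auto
  define u where "u = mat N N (\<lambda>(i, j). coord N e i (w j))"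
  have u: "u \<in> lower_unipotent N"
    using w(2) by (auto simp: lower_unipotent_def u_def)
  have "fdet m (\<lambda>i j. u $$ (r i, j)) > 0" if r: "strict_mono_on {..<m} r" "r ` {..<m} \<subseteq> {..<N}" for m r
  proof -
    have mN: "m \<le> N"
      using card_mono[OF _ r(2)] card_image[OF strict_mono_on_imp_inj_on[OF r(1)]] by simp
    obtain s where s: "\<And>f. (\<And>a. a < m \<Longrightarrow> linear (f a)) \<Longrightarrow>
        fdet m (\<lambda>a i. f a (w i)) = s * fdet m (\<lambda>a i. f a (c i))"
      using minors_proportional[of m w c] w_span[OF _ mN] by blast
    obtain \<sigma> where \<sigma>: "\<And>r. strict_mono_on {..<m} r \<Longrightarrow> r ` {..<m} \<subseteq> {..<N} \<Longrightarrow>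
        \<sigma> * fdet m (\<lambda>i j. coord N e (r i) (c j)) > 0"
      using c[OF mN] by (auto simp: same_sign_minors_def)
    have "s * fdet m (\<lambda>i j. coord N e i (c j)) = 1"
      using s[of "coord N e"] leading[OF mN] linear_coord[OF e] by simp
    moreover have "\<sigma> * fdet m (\<lambda>i j. coord N e i (c j)) > 0" "\<sigma> * fdet m (\<lambda>i j. coord N e (r i) (c j)) > 0"
      using \<sigma>[OF id[OF mN]] \<sigma>[OF r] by simp_all
    ultimately have "s * fdet m (\<lambda>i j. coord N e (r i) (c j)) > 0"
      by (smt (verit) mult_eq_0_iff zero_less_mult_iff)
    moreover have "fdet m (\<lambda>i j. u $$ (r i, j)) = fdet m (\<lambda>i j. coord N e (r i) (w j))"
      using r(2) mN by (intro fdet_cong) (auto simp: u_def)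
    ultimately show ?thesis
      using s[of "\<lambda>i. coord N e (r i)"] linear_coord[OF e] by simp
  qed
  then have tp: "u \<in> totally_positive_unipotent N"
    by (intro totally_positive_unipotentI[OF u]) (simp add: flag_minors_positive_def)
  have ind: "inj_on w {..<m}" "independent (w ` {..<m})" if "m \<le> N" for m
    using independent_of_minor[of m "coord N e" w] linear_coord[OF e] leading[OF that] by simp_all
  have "span (w ` {..<m}) = span (c ` {..<m})" if "m \<le> N" for m
    using ind[OF that] w_span[OF _ that] by (rule span_eq_of_independent)
  moreover have "dim (span (w ` {..<m})) = m" if "m \<le> N" for m
    using dim_span_eq_card_independent[OF ind(2)[OF that]] card_image[OF ind(1)[OF that]] by simp
  ultimately show ?thesis
    using tp by (intro exI[of _ w] bexI[of _ u]) (auto simp: u_def)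
qed

section \<open>The two positive parts of the Grassmannian\<close>

lemma pluecker_positive_imp_totally_positive:
  fixes e :: "nat \<Rightarrow> 'v::real_vector"
  assumes e: "ordered_basis N e" and k: "k \<in> {1..N - 1}"
    and E: "E \<in> pluecker_positive_grassmannian N e k"
  shows "E \<in> totally_positive_grassmannian N e k"
proof -
  have kN: "k \<le> N"
    using k by auto
  obtain \<omega> where dimE: "subspace E" "dim E = k" and \<omega>: "exterior_power k E = span {\<omega>}"
    and pos: "\<And>I. I \<subseteq> {..<N} \<Longrightarrow> card I = k \<Longrightarrow>
      representation (wedge_basis e ` {I. I \<subseteq> {..<N} \<and> card I = k}) \<omega> (wedge_basis e I) > 0"
    using E by (auto simp: pluecker_positive_grassmannian_def grassmannian_def)
  obtain B where B: "B \<subseteq> E" "independent B" "E \<subseteq> span B" "card B = k"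
    using basis_exists[of E] dimE(2) by metis
  have "finite B"
    using B(4) k card.infinite by fastforce
  then obtain b where "bij_betw b {0..<k} B"
    using ex_bij_betw_nat_finite[of B] B(4) by blast
  then have "B = b ` {..<k}"
    by (simp add: bij_betw_def lessThan_atLeast0)
  moreover have "span B = E"
    using B dimE(1) by (simp add: span_minimal subset_antisym)
  ultimately have Eb: "E = span (b ` {..<k})"
    by simp
  have "\<omega> \<in> span {wedge (map b [0..<k])}"
    using \<omega> span_base[of \<omega> "{\<omega>}"] unfolding Eb exterior_power_span by simp
  then obtain s where s: "\<omega> = s *\<^sub>R wedge (map b [0..<k])"
    by (auto simp: span_singleton)
  have "s * fdet k (\<lambda>i j. coord N e (r i) (b j)) > 0"
    if r: "strict_mono_on {..<k} r" "r ` {..<k} \<subseteq> {..<N}" for r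
    using pos[OF r(2)] card_image[OF strict_mono_on_imp_inj_on[OF r(1)]]
    unfolding s pluecker_coordinate[OF e r] by simp
  then have "same_sign_minors N e k b"
    unfolding same_sign_minors_def by blast
  then obtain d where d: "span (d ` {..<k}) = E" "\<And>j. j \<le> k \<Longrightarrow> same_sign_minors N e j d"
    using same_sign_flag_below[OF e, of k b] kN unfolding Eb by blast
  obtain c where c: "\<And>j. j < k \<Longrightarrow> c j = d j" "\<And>j. j \<le> k + (N - k) \<Longrightarrow> same_sign_minors N e j c"
    using same_sign_flag_above[OF e d(2), of k "N - k"] by blast
  have "same_sign_minors N e j c" if "j \<le> N" for j
    using c(2) that by simp
  with e have "\<exists>w. \<exists>u\<in>totally_positive_unipotent N.
      (\<forall>i<N. \<forall>j<N. u $$ (i, j) = coord N e i (w j)) \<and>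
      (\<forall>m\<le>N. span (w ` {..<m}) = span (c ` {..<m}) \<and> dim (span (w ` {..<m})) = m)"
    by (rule unipotent_basis)
  then obtain w u where u: "u \<in> totally_positive_unipotent N"
    and uw: "\<And>i j. i < N \<Longrightarrow> j < N \<Longrightarrow> u $$ (i, j) = coord N e i (w j)"
    and wc: "\<And>m. m \<le> N \<Longrightarrow> span (w ` {..<m}) = span (c ` {..<m})"
    and dim: "\<And>m. m \<le> N \<Longrightarrow> dim (span (w ` {..<m})) = m"
    by blast
  define F where "F = (\<lambda>i\<in>{1..N - 1}. span (w ` {..<i}))"
  have "F \<in> complete_flags N"
    using dim by (auto simp: complete_flags_def F_def grassmannian_def intro!: span_mono image_mono)
  moreover have "F i = mat_action N e u ` span (e ` {..<i})" if "i \<in> {1..N - 1}" for i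
  proof -
    have "mat_action N e u (e j) = w j" if "j < N" for j
      using mat_action_basis[OF e that, of u] coord_sum[OF e, of "w j"] uw that by simp
    then have "mat_action N e u ` e ` {..<i} = w ` {..<i}"
      using that by (auto simp: image_image intro!: image_cong)
    then show ?thesis
      using that linear_span_image[OF linear_mat_action[OF e], of u "e ` {..<i}"] by (simp add: F_def)
  qed
  ultimately have "F \<in> totally_positive_flags N e"
    using u unfolding totally_positive_flags_def by blast
  moreover have "F k = E"
  proof -
    have "c ` {..<k} = d ` {..<k}"
      using c(1) by (intro image_cong) auto
    then show ?thesis
      using wc[OF kN] k d(1) by (simp add: F_def)
  qed
  ultimately show ?thesis
    unfolding totally_positive_grassmannian_def by blast
qed

lemma totally_positive_imp_pluecker_positive:
  fixes e :: "nat \<Rightarrow> 'v::real_vector"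
  assumes e: "ordered_basis N e" and k: "k \<in> {1..N - 1}"
    and E: "E \<in> totally_positive_grassmannian N e k"
  shows "E \<in> pluecker_positive_grassmannian N e k"
proof -
  obtain F u where F: "F \<in> complete_flags N" "E = F k" and u: "u \<in> totally_positive_unipotent N"
    and Fk: "F k = mat_action N e u ` span (e ` {..<k})"
    using E k by (auto simp: totally_positive_grassmannian_def totally_positive_flags_def)
  have uN: "u \<in> lower_unipotent N" "u \<in> carrier_mat N N"
    using u by (auto simp: totally_positive_unipotent_def lower_unipotent_def)
  have E_grass: "E \<in> grassmannian k"
    using F k by (auto simp: complete_flags_def)
  define b where "b j = mat_action N e u (e j)" for j
  have "E = span (b ` {..<k})"
    unfolding F(2) Fk b_def
    using linear_span_image[OF linear_mat_action[OF e], of u "e ` {..<k}"] by (simp add: image_image)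
  then have ext: "exterior_power k E = span {wedge (map b [0..<k])}"
    by (simp add: exterior_power_span)
  have coord_b: "coord N e i (b j) = u $$ (i, j)" if "i < N" "j < N" for i j
  proof -
    have "coord N e i (b j) = (\<Sum>l<N. u $$ (l, j) * (if i = l then 1 else 0))"
      unfolding b_def mat_action_basis[OF e that(2)] using that(1)
      by (simp add: linear_sum[OF linear_coord[OF e]] linear_cmul[OF linear_coord[OF e]] coord_basis[OF e])
    also have "\<dots> = (\<Sum>l<N. if i = l then u $$ (l, j) else 0)"
      by (intro sum.cong) auto
    finally show ?thesis
      using that by simp
  qed
  have "representation (wedge_basis e ` {I. I \<subseteq> {..<N} \<and> card I = k})
      (wedge (map b [0..<k])) (wedge_basis e I) > 0" if I: "I \<subseteq> {..<N}" "card I = k" for I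
  proof -
    obtain r where r: "strict_mono_on {..<k} r" "r ` {..<k} = I"
      using ex_strict_mono_enumeration[OF I] by blast
    have id: "strict_mono_on {..<k} (\<lambda>i :: nat. i)" "(\<lambda>i. i) ` {..<k} \<subseteq> {..<N}"
      using k by (auto intro!: strict_mono_onI)
    have "pick {..<k} a \<le> pick I a" if "a < k" for a
      using pick_image_strict_mono_on[OF r(1) that] pick_image_strict_mono_on[OF id(1) that]
        strict_mono_on_add_le[OF r(1), of 0 a] that r(2) by simp
    then have "\<exists>w\<in>lower_unipotent N. minor w I {..<k} \<noteq> 0"
      using nonvanishing_minor_iff[of I N "{..<k}"] I id(2) by simp
    moreover have "I \<noteq> {}"
      using I(2) k by auto
    ultimately have "minor u I {..<k} > 0"
      using u I id(2) unfolding totally_positive_unipotent_def by simp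
    also have "minor u I {..<k} = fdet k (\<lambda>i j. u $$ (r i, j))"
      using minor_image[OF uN(2) r(1) _ id] r(2) I(1) by simp
    also have "\<dots> = fdet k (\<lambda>i j. coord N e (r i) (b j))"
      using r(2) I(1) k by (intro fdet_cong) (auto simp: coord_b)
    finally show ?thesis
      using pluecker_coordinate[OF e r(1), of 1 b] r(2) I(1) by simp
  qed
  then show ?thesis
    using E_grass ext by (auto simp: pluecker_positive_grassmannian_def)
qed

theorem theorem0p5:
  fixes e :: "nat \<Rightarrow> 'v::real_vector" and N k :: nat
  assumes "N \<ge> 2" and "ordered_basis N e" and "k \<in> {1..N - 1}"
  shows "pluecker_positive_grassmannian N e k = totally_positive_grassmannian N e k"
  using pluecker_positive_imp_totally_positive[OF assms(2,3)]
    totally_positive_imp_pluecker_positive[OF assms(2,3)] by blast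

end
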